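(* (Parking function version of the Lidskii volume formula) Let $G$ be a connected directed graph on the $n+1$ vertices $[n+1]$ with shifted out-degree vector $\mathbf{t}=(t_1,\ldots,t_n)$, and let $\mathbf{a}=(a_1,\ldots,a_n)$ be a nonnegative integer net flow vector. Then $$\operatorname{vol}\mathcal{F}_G(\mathbf{a})=\sum_{(\mathbf{s},\sigma)\in\mathrm{PF}_{\mathbf{t}}}\mathbf{a}^{\mathbf{s}}\cdot K_{G|_n}(\mathbf{s}-\mathbf{t}),$$ where the sum is over all labeled $\mathbf{t}$-Dyck paths $(\mathbf{s},\sigma)$.
   Context: Directed graphs $G$ have vertex set $[n+1]=\{1,\ldots,n+1\}$, may have multiple edges, and every edge $(i,j)$ is directed from smaller vertex $i$ to larger vertex $j$; $m=|E(G)|$. The shifted out-degree vector is $\mathbf{t}=(t_1,\ldots,t_n)$, $t_i=(\text{out-degree of }i)-1$; $|\mathbf{t}|=\sum t_i=m-n$. $G|_n$ is the restriction of $G$ to the vertices $1,\ldots,n$. $\mathbf{a}^{\mathbf{s}}=a_1^{s_1}\cdots a_n^{s_n}$ with $0^0=1$. Flow polytope: $\mathcal{F}_G(\mathbf{a})\subset\mathbb{R}^m$ is the set of tuples $(b_e)_{e\in E(G)}$ of nonnegative reals such that for each $j=1,\ldots,n$, (sum of $b_e$ over edges leaving $j$) minus (sum of $b_e$ over edges entering $j$) equals $a_j$. It lies in an affine subspace of dimension $m-n$, and $\operatorname{vol}$ is normalized volume: $(m-n)!$ times the $(m-n)$-dimensional volume, normalized so that a fundamental cell of the lattice of integer points of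 the linear subspace parallel to this affine subspace has volume $1$ (so $\operatorname{vol}=0$ if the polytope has dimension less than $m-n$). Kostant partition function: for $\mathbf{v}\in\mathbb{Z}^n$ with entry sum $0$, $K_{G|_n}(\mathbf{v})$ is the number of nonnegative integer tuples $(b_e)_{e\in E(G|_n)}$ with $\sum_{e=(i,j)}b_e(\mathbf{e}_i-\mathbf{e}_j)=\mathbf{v}$, where $\mathbf{e}_i$ are the standard basis vectors. A $\mathbf{t}$-Dyck path is a sequence of nonnegative integers $\mathbf{s}=(s_1,\ldots,s_n)$ with sum $|\mathbf{t}|$ and $\sum_{j\le k}s_j\ge\sum_{j\le k}t_j$ for all $k$, identified with the lattice path $N^{s_1}EN^{s_2}E\cdots N^{s_n}E$. A labeled $\mathbf{t}$-Dyck path is a pair $(\mathbf{s},\sigma)$ with $\mathbf{s}$ a $\mathbf{t}$-Dyck path and $\sigma$ a permutation of $[|\mathbf{t}|]$ labeling the north steps in order along the path, such that labels increase along consecutive north steps, i.e. descents of $\sigma$ occur only at positions $s_1+\cdots+s_i$. $\mathrm{PF}_{\mathbf{t}}$ is the set of labeled $\mathbf{t}$-Dyck paths.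
   Formalization: Added: every vertex i ≤ n with a_i = 0 has at least one outgoing edge. Without this the formula fails: for n = 2, edges (1,2),(1,3), a = (a_1,0), the volume is 1 but t = (1,-1) admits no t-Dyck path, so the sum is 0. *)

theory Defs
  imports
    "HOL-Analysis.Analysis"
    "HOL-Combinatorics.Permutations"
    "Graph_Theory.Digraph_Component"
begin

(* A point of R^E, for a finite set E, is a function in E \<rightarrow>\<^sub>E UNIV; likewise vectors indexed by
   1, ..., n are functions on {1..n}. *)

definition shifted_out_degree :: "(nat, 'e) pre_digraph \<Rightarrow> nat \<Rightarrow> int" where
  "shifted_out_degree G i = int (out_degree G i) - 1"


definition net_flow :: "(nat, 'e) pre_digraph \<Rightarrow> ('e \<Rightarrow> real) \<Rightarrow> nat \<Rightarrow> real" where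
  "net_flow G b j = (\<Sum>e\<in>out_arcs G j. b e) - (\<Sum>e\<in>in_arcs G j. b e)"

definition flow_space :: "(nat, 'e) pre_digraph \<Rightarrow> nat \<Rightarrow> (nat \<Rightarrow> real) \<Rightarrow> ('e \<Rightarrow> real) set" where
  "flow_space G n a = {b \<in> arcs G \<rightarrow>\<^sub>E UNIV. \<forall>j\<in>{1..n}. net_flow G b j = a j}"

definition flow_polytope :: "(nat, 'e) pre_digraph \<Rightarrow> nat \<Rightarrow> (nat \<Rightarrow> real) \<Rightarrow> ('e \<Rightarrow> real) set" where
  "flow_polytope G n a = {b \<in> flow_space G n a. \<forall>e\<in>arcs G. 0 \<le> b e}"


definition direction_space :: "'e set \<Rightarrow> ('e \<Rightarrow> real) set \<Rightarrow> ('e \<Rightarrow> real) set" where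
  "direction_space E A = {\<lambda>e\<in>E. x e - y e | x y. x \<in> A \<and> y \<in> A}"

definition lattice_basis :: "'e set \<Rightarrow> ('e \<Rightarrow> real) set \<Rightarrow> nat \<Rightarrow> (nat \<Rightarrow> 'e \<Rightarrow> real) \<Rightarrow> bool" where
  "lattice_basis E L d B \<longleftrightarrow>
     L = {\<lambda>e\<in>E. \<Sum>i<d. of_int (k i) * B i e | k :: nat \<Rightarrow> int. True} \<and>
     (\<forall>x :: nat \<Rightarrow> real. (\<forall>e\<in>E. (\<Sum>i<d. x i * B i e) = 0) \<longrightarrow> (\<forall>i<d. x i = 0))"

(* The d-dimensional volume of a subset S of a d-dimensional affine subspace A of R^E: S is
   measured by Lebesgue measure in the coordinates given by an origin p in A and a basis B of the
   lattice of integer points of the linear subspace parallel to A, so that a fundamental cell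
   has volume 1. The value does not depend on the choices: changing p is a translation of the
   coordinate space, and two bases of the lattice differ by an integer matrix of determinant
   1 or -1. *)
definition lattice_volume :: "'e set \<Rightarrow> nat \<Rightarrow> ('e \<Rightarrow> real) set \<Rightarrow> ('e \<Rightarrow> real) set \<Rightarrow> real" where
  "lattice_volume E d A S =
     (let p = (SOME p. p \<in> A);
          B = (SOME B. lattice_basis E (direction_space E A \<inter> (E \<rightarrow>\<^sub>E \<int>)) d B)
      in measure (\<Pi>\<^sub>M i\<in>{..<d}. lborel)
           {x \<in> {..<d} \<rightarrow>\<^sub>E UNIV. (\<lambda>e\<in>E. p e + (\<Sum>i<d. x i * B i e)) \<in> S})"

definition flow_volume :: "(nat, 'e) pre_digraph \<Rightarrow> nat \<Rightarrow> (nat \<Rightarrow> real) \<Rightarrow> real" where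
  "flow_volume G n a =
     fact (card (arcs G) - n) *
     lattice_volume (arcs G) (card (arcs G) - n) (flow_space G n a) (flow_polytope G n a)"


definition unit_vec :: "nat \<Rightarrow> nat \<Rightarrow> int" where
  "unit_vec i k = (if k = i then 1 else 0)"

(* H is a graph on the vertices 1, ..., n whose arcs go from smaller to larger vertices; then the
   set counted here is finite. *)
definition kostant :: "(nat, 'e) pre_digraph \<Rightarrow> nat \<Rightarrow> (nat \<Rightarrow> int) \<Rightarrow> nat" where
  "kostant H n v =
     card {b \<in> arcs H \<rightarrow>\<^sub>E (UNIV :: nat set).
             \<forall>k\<in>{1..n}. (\<Sum>e\<in>arcs H. int (b e) * (unit_vec (tail H e) k - unit_vec (head H e) k)) = v k}"


definition dyck_paths :: "nat \<Rightarrow> (nat \<Rightarrow> int) \<Rightarrow> (nat \<Rightarrow> nat) set" where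
  "dyck_paths n t =
     {s \<in> {1..n} \<rightarrow>\<^sub>E UNIV.
        (\<Sum>j=1..n. int (s j)) = (\<Sum>j=1..n. t j) \<and>
        (\<forall>k\<in>{1..n}. (\<Sum>j=1..k. t j) \<le> (\<Sum>j=1..k. int (s j)))}"

(* \<sigma> p is the label of the p-th north step. *)
definition labeled_dyck_paths :: "nat \<Rightarrow> (nat \<Rightarrow> int) \<Rightarrow> ((nat \<Rightarrow> nat) \<times> (nat \<Rightarrow> nat)) set" where
  "labeled_dyck_paths n t =
     {(s, \<sigma>). s \<in> dyck_paths n t \<and> \<sigma> permutes {1..nat (\<Sum>j=1..n. t j)} \<and>
        (\<forall>p. 1 \<le> p \<and> p < nat (\<Sum>j=1..n. t j) \<and> \<sigma> p > \<sigma> (p + 1)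
               \<longrightarrow> (\<exists>i\<in>{1..n}. p = (\<Sum>j=1..i. s j)))}"

end

(* In each vertex v with outgoing arcs choose one of them, tau v. The remaining "free" arcs are
   coordinates on the flow space: the flow on tau v is forced by the conservation law, and the
   integer circulations obtained by closing up a free arc along the chosen ones form a basis of the
   lattice. Lebesgue measure does not distinguish unimodular coordinate systems, so the volume may
   be computed in these coordinates.

   There the volume formula follows by removing an arc e = (i, j) leaving the first vertex i. If i
   has another arc, e may be taken free, and carrying y along e changes the net flow vector a to
   a - y e_i + y e_j, so that the volume is an integral over y in [0, a_i]; in divided powers
   a^s / s! this integral yields exactly one summand for each possible value of the integer flow
   on e that the Kostant partition function counts. If e is the only arc at i, its flow is a_i and
   the binomial theorem takes the place of the integral.

   Finally |t|! / (s_1! ... s_n!) is the number of admissible labelings of the path s. *)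

theory Submission
  imports Defs
begin

section \<open>Divided powers\<close>

text \<open>The recursion leaves the connected graphs on [n+1]: deleting arcs can strip a vertex of
  its outgoing arcs. So no vertex set is carried along. Conservation is imposed exactly at the
  current sources, every other vertex is a sink like n + 1, and the dimension |A| - |sources| keeps
  pace with the deletions. The first vertex is the right place to delete because no arc enters it:
  its net flow is a pure outflow. This bounds the integral by a_i, forces the flow on a sole arc,
  and makes the sign condition on the exponent at i automatic, so that only the exponent at j limits
  the flow on the deleted arc. The volume refers to an unspecified lattice basis, of which nothing
  is known but that it is one. It is compared with the tree coordinates across different index sets,
  numbers and arcs, hence without a determinant: Fubini reduces the comparison to the fact that a
  measurable set meeting every class modulo the integer lattice exactly once has measure 1.\<close>

definition divided_power :: "real \<Rightarrow> nat \<Rightarrow> real" where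
  "divided_power x k = x ^ k / fact k"

lemma divided_power_nonneg: "0 \<le> x \<Longrightarrow> 0 \<le> divided_power x k"
  by (simp add: divided_power_def)

text \<open>Absorbing the factorials removes the coefficients from the binomial theorem, so that
  each split into k and q - k can later be matched with a single flow.\<close>

lemma divided_power_add:
  "divided_power (x + y) q = (\<Sum>k\<le>q. divided_power x k * divided_power y (q - k))"
proof -
  have "of_nat (q choose k) * x ^ k * y ^ (q - k) / fact q
      = divided_power x k * divided_power y (q - k)" if "k \<le> q" for k
    using that by (simp add: divided_power_def binomial_fact field_simps)
  then show ?thesis
    by (simp add: divided_power_def binomial_ring sum_divide_distrib)
qed

lemma has_real_derivative_divided_power_Suc:
  "((\<lambda>x. divided_power x (Suc k)) has_real_derivative divided_power x k) (at x)"
  unfolding divided_power_def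
  by (rule derivative_eq_intros refl | simp)+

lemma has_real_derivative_divided_power:
  "((\<lambda>x. divided_power x k) has_real_derivative
      (if k = 0 then 0 else divided_power x (k - 1))) (at x)"
  by (cases k) (auto simp: divided_power_def[of _ 0] intro!: has_real_derivative_divided_power_Suc)

text \<open>Repeated integration by parts: each step raises the index of \<open>u - y\<close> and
  lowers that of \<open>w + y\<close>, until the latter reaches 0. Summand k will be the term with
  flow k on the removed arc.\<close>

lemma has_real_derivative_transfer_divided_power:
  "((\<lambda>y. - (\<Sum>k\<le>q. divided_power (u - y) (p + 1 + k) * divided_power (w + y) (q - k)))
     has_real_derivative divided_power (u - y) p * divided_power (w + y) q) (at y)"
proof -
  have 1: "((\<lambda>y. divided_power (u - y) (Suc k)) has_real_derivative - divided_power (u - y) k) (at y)"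
    for k y
    using DERIV_chain2[OF has_real_derivative_divided_power_Suc DERIV_diff[OF DERIV_const DERIV_ident], of u k y] by simp
  have 2: "((\<lambda>y. divided_power (w + y) k) has_real_derivative
      (if k = 0 then 0 else divided_power (w + y) (k - 1))) (at y)" for k y
    using DERIV_chain2[OF has_real_derivative_divided_power DERIV_add[OF DERIV_const DERIV_ident], of w k y] by simp
  \<comment> \<open>The cutoff at k > q encodes the vanishing derivative of the constant
    \<open>divided_power (w + y) 0\<close>; with it the derivatives of the summands telescope to
    \<open>- g 0\<close>.\<close>
  define g where "g k = (if k \<le> q then divided_power (u - y) (p + k) * divided_power (w + y) (q - k) else 0)" for k
  have d: "((\<lambda>y. divided_power (u - y) (p + 1 + k) * divided_power (w + y) (q - k)) has_real_derivative
      g (Suc k) - g k) (at y)" if "k \<le> q" for k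
    by (rule derivative_eq_intros 1[of "p + k", simplified] 2 refl | simp)+
      (use that in \<open>auto simp: g_def\<close>)
  have "((\<lambda>y. - (\<Sum>k\<le>q. divided_power (u - y) (p + 1 + k) * divided_power (w + y) (q - k)))
     has_real_derivative - (\<Sum>k\<le>q. g (Suc k) - g k)) (at y)"
    by (intro DERIV_minus DERIV_sum d) auto
  moreover have "(\<Sum>k\<le>q. g (Suc k) - g k) = - g 0"
    using sum_lessThan_telescope[of g "Suc q"] by (simp add: lessThan_Suc_atMost g_def)
  ultimately show ?thesis by (simp add: g_def)
qed

section \<open>Tree coordinates on spaces of flows\<close>

text \<open>A sum over all arcs rather than over those incident with \<open>v\<close>, so that
  inserting an arc adds one term at every vertex. Polymorphic because it serves both real flows and
  the integer flows of the Kostant partition function.\<close>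

definition net :: "('e \<Rightarrow> nat) \<Rightarrow> ('e \<Rightarrow> nat) \<Rightarrow> 'e set \<Rightarrow> ('e \<Rightarrow> 'a::ab_group_add) \<Rightarrow> nat \<Rightarrow> 'a" where
  "net src tgt A b v = (\<Sum>e\<in>A. (if src e = v then b e else 0) - (if tgt e = v then b e else 0))"

lemma net_cong: "(\<And>e. e \<in> A \<Longrightarrow> b e = b' e) \<Longrightarrow> net src tgt A b v = net src tgt A b' v"
  by (auto simp: net_def intro!: sum.cong)

lemma net_insert:
  "finite A \<Longrightarrow> e \<notin> A \<Longrightarrow> net src tgt (insert e A) b v =
     (if src e = v then b e else 0) - (if tgt e = v then b e else 0) + net src tgt A b v"
  by (simp add: net_def)

lemma net_diff: "net src tgt A (\<lambda>e. b e - b' e) v = net src tgt A b v - net src tgt A b' v"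
  unfolding net_def sum_subtractf[symmetric] by (intro sum.cong) auto

lemma net_add: "net src tgt A (\<lambda>e. b e + b' e) v = net src tgt A b v + net src tgt A b' v"
  unfolding net_def sum.distrib[symmetric] by (intro sum.cong) auto

lemma net_mult: "net src tgt A (\<lambda>e. c * (b e :: 'a::comm_ring)) v = c * net src tgt A b v"
  unfolding net_def sum_distrib_left by (intro sum.cong) (auto simp: algebra_simps)

lemma net_sum:
  "net src tgt A (\<lambda>e. \<Sum>i\<in>J. c i * (b i e :: 'a::comm_ring)) v = (\<Sum>i\<in>J. c i * net src tgt A (b i) v)"
proof (induction J rule: infinite_finite_induct)
  case (insert i J)
  then show ?case by (simp add: net_add net_mult)
qed (simp_all add: net_def)

lemma net_of_int: "net src tgt A (\<lambda>e. of_int (b e)) v = (of_int (net src tgt A b v) :: 'a::ring_1)"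
  unfolding net_def of_int_sum by (intro sum.cong) auto

text \<open>Arcs increase, so following \<open>\<tau>\<close> from a source ends at a vertex outside
  \<open>sources\<close>: the chosen arcs form a forest rooted at the sinks, the counterpart of a
  spanning tree once all sinks are identified.\<close>

locale rooted_arcs =
  fixes src tgt :: "'e \<Rightarrow> nat" and A :: "'e set" and \<tau> :: "nat \<Rightarrow> 'e"
  assumes finite_arcs: "finite A"
    and src_less_tgt: "e \<in> A \<Longrightarrow> src e < tgt e"
    and root_in: "v \<in> src ` A \<Longrightarrow> \<tau> v \<in> A"
    and src_root: "v \<in> src ` A \<Longrightarrow> src (\<tau> v) = v"
begin

abbreviation "sources \<equiv> src ` A"
abbreviation "free_arcs \<equiv> A - \<tau> ` sources"

lemma card_free_arcs: "card free_arcs = card A - card sources"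
proof -
  have "inj_on \<tau> sources" by (metis inj_onI src_root)
  then show ?thesis
    using finite_arcs root_in by (subst card_Diff_subset) (auto simp: card_image)
qed

text \<open>Induction along increasing sources: arcs entering \<open>src e\<close> start earlier and
  are already zero, the other arcs leaving it are free, so conservation leaves only
  \<open>b e\<close>.\<close>

lemma net_eq_0_imp_eq_0:
  fixes b :: "'e \<Rightarrow> 'a::ab_group_add"
  assumes net: "\<And>v. v \<in> sources \<Longrightarrow> net src tgt A b v = 0"
    and free: "\<And>f. f \<in> free_arcs \<Longrightarrow> b f = 0"
    and "e \<in> A"
  shows "b e = 0"
  using \<open>e \<in> A\<close>
proof (induction "src e" arbitrary: e rule: less_induct)
  case less
  show ?case
  proof (cases "e \<in> free_arcs")
    case False
    then have e: "e = \<tau> (src e)" using less.prems src_root by auto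
    have "0 = net src tgt A b (src e)" using net less.prems by simp
    also have "\<dots> = (\<Sum>f\<in>A. if f = e then b e else 0)"
      unfolding net_def
    proof (intro sum.cong refl)
      fix f assume f: "f \<in> A"
      have "b f = 0" if "tgt f = src e" using less.hyps[of f] f that src_less_tgt[OF f] by auto
      moreover have "b f = 0" if "src f = src e" "f \<noteq> e"
      proof (rule free)
        show "f \<in> free_arcs" using that e f src_root by auto
      qed
      moreover have "tgt e \<noteq> src e" using src_less_tgt[OF less.prems] by simp
      ultimately show "(if src f = src e then b f else 0) - (if tgt f = src e then b f else 0)
          = (if f = e then b e else 0)" by auto
    qed
    also have "\<dots> = b e" using less.prems finite_arcs by simp
    finally show ?thesis by simp
  qed (use free in auto)
qed

lemma flow_eqI:
  fixes b b' :: "'e \<Rightarrow> 'a::ab_group_add"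
  assumes "\<And>v. v \<in> sources \<Longrightarrow> net src tgt A b v = net src tgt A b' v"
    and "\<And>f. f \<in> free_arcs \<Longrightarrow> b f = b' f" and "e \<in> A"
  shows "b e = b' e"
  using net_eq_0_imp_eq_0[of "\<lambda>e. b e - b' e" e] assms by (auto simp: net_diff)

text \<open>\<open>D\<close> is the indicator of the chosen path from \<open>v\<close> to a sink:
  add the arc \<open>\<tau> v\<close> to the path of its target, a larger vertex. A vertex outside
  \<open>sources\<close> gets 0.\<close>

lemma ex_root_path:
  "\<exists>D :: 'e \<Rightarrow> int. (\<forall>w\<in>sources. net src tgt A D w = (if w = v then 1 else 0)) \<and>
     (\<forall>f\<in>free_arcs. D f = 0)"
proof (cases "sources = {}")
  case True
  then show ?thesis by (intro exI[of _ "\<lambda>_. 0"]) auto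
next
  case False
  define M where "M = Max sources"
  have fin: "finite sources" using finite_arcs by simp
  show ?thesis
  \<comment> \<open>\<open>Suc M\<close> and not \<open>M\<close>: the target of
    \<open>\<tau> M\<close> lies beyond \<open>M\<close>, and the measure must still drop.\<close>
  proof (induction "Suc M - v" arbitrary: v rule: less_induct)
    case less
    show ?case
    proof (cases "v \<in> sources")
      case False
      then show ?thesis by (intro exI[of _ "\<lambda>_. 0"]) (auto simp: net_def)
    next
      case True
      then have le: "v \<le> M" unfolding M_def using fin by simp
      have t: "v < tgt (\<tau> v)" using src_less_tgt[OF root_in[OF True]] src_root[OF True] by simp
      obtain D :: "'e \<Rightarrow> int" where
        D: "\<forall>w\<in>sources. net src tgt A D w = (if w = tgt (\<tau> v) then 1 else 0)"
          "\<forall>f\<in>free_arcs. D f = 0"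
        using less.hyps[of "tgt (\<tau> v)"] diff_less_mono2[OF t, of "Suc M"] le less_Suc_eq_le by blast
      have "net src tgt A (\<lambda>e. if e = \<tau> v then 1 else 0 :: int) w
          = (if w = v then 1 else 0) - (if w = tgt (\<tau> v) then 1 else 0)" for w
      proof -
        have "net src tgt A (\<lambda>e. if e = \<tau> v then 1 else 0 :: int) w =
          (\<Sum>e\<in>A. if e = \<tau> v then (if w = v then 1 else 0) - (if w = tgt (\<tau> v) then 1 else 0) else 0)"
          unfolding net_def using src_root[OF True] by (intro sum.cong) auto
        then show ?thesis using root_in[OF True] finite_arcs by simp
      qed
      then show ?thesis
        using D root_in[OF True] True
        by (intro exI[of _ "\<lambda>e. D e + (if e = \<tau> v then 1 else 0)"]) (auto simp: net_add)
    qed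
  qed
qed

definition root_path :: "nat \<Rightarrow> 'e \<Rightarrow> int" where
  "root_path v = (SOME D. (\<forall>w\<in>sources. net src tgt A D w = (if w = v then 1 else 0)) \<and>
     (\<forall>f\<in>free_arcs. D f = 0))"

lemma
  shows net_root_path: "w \<in> sources \<Longrightarrow> net src tgt A (root_path v) w = (if w = v then 1 else 0)"
    and root_path_free: "f \<in> free_arcs \<Longrightarrow> root_path v f = 0"
  using someI_ex[OF ex_root_path[of v], folded root_path_def] by blast+

text \<open>A unit on \<open>f\<close> moves from \<open>src f\<close> to \<open>tgt f\<close>; the
  chosen path from \<open>tgt f\<close> carries it on, and the reversed one from
  \<open>src f\<close> compensates. The paths may end at different sinks, so this is a cycle only
  after identifying the sinks.\<close>

definition cycle :: "'e \<Rightarrow> 'e \<Rightarrow> int" where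
  "cycle f e = (if e = f then 1 else 0) + (root_path (tgt f) e - root_path (src f) e)"

lemma net_cycle:
  assumes "f \<in> A" "w \<in> sources"
  shows "net src tgt A (cycle f) w = 0"
proof -
  have "net src tgt A (\<lambda>e. if e = f then 1 else 0 :: int) w =
      (\<Sum>e\<in>A. if e = f then (if src f = w then 1 else 0) - (if tgt f = w then 1 else 0) else 0)"
    unfolding net_def by (intro sum.cong) auto
  also have "\<dots> = (if src f = w then 1 else 0) - (if tgt f = w then 1 else 0)"
    using assms finite_arcs by simp
  finally have 1: "net src tgt A (\<lambda>e. if e = f then 1 else 0 :: int) w = \<dots>" .
  show ?thesis
    unfolding cycle_def
    by (subst net_add, subst net_diff) (auto simp: net_root_path[OF assms(2)] 1)
qed

lemma cycle_free: "g \<in> free_arcs \<Longrightarrow> cycle f g = (if g = f then 1 else 0)"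
  by (simp add: cycle_def root_path_free)

text \<open>The root paths give one solution of the conservation law that vanishes on the free arcs;
  the cycles then adjust the free arcs independently.\<close>

definition flow_of :: "(nat \<Rightarrow> real) \<Rightarrow> ('e \<Rightarrow> real) \<Rightarrow> 'e \<Rightarrow> real" where
  "flow_of a x e = (\<Sum>v\<in>sources. a v * root_path v e) + (\<Sum>f\<in>free_arcs. x f * cycle f e)"

lemma net_flow_of:
  assumes "w \<in> sources"
  shows "net src tgt A (flow_of a x) w = a w"
proof -
  have "net src tgt A (flow_of a x) w =
      (\<Sum>v\<in>sources. a v * of_int (net src tgt A (root_path v) w)) +
      (\<Sum>f\<in>free_arcs. x f * of_int (net src tgt A (cycle f) w))"
    unfolding flow_of_def net_add net_sum net_of_int ..
  also have "(\<Sum>f\<in>free_arcs. x f * of_int (net src tgt A (cycle f) w)) = 0"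
    using assms by (intro sum.neutral) (auto simp: net_cycle)
  also have "(\<Sum>v\<in>sources. a v * of_int (net src tgt A (root_path v) w)) = (\<Sum>v\<in>sources. if v = w then a v else 0)"
    using assms by (intro sum.cong) (auto simp: net_root_path)
  also have "\<dots> = a w" using assms finite_arcs by simp
  finally show ?thesis by simp
qed

lemma flow_of_free:
  assumes "f \<in> free_arcs"
  shows "flow_of a x f = x f"
proof -
  have "(\<Sum>g\<in>free_arcs. x g * cycle g f) = (\<Sum>g\<in>free_arcs. if g = f then x g else 0)"
    using assms by (intro sum.cong) (auto simp: cycle_free)
  then show ?thesis
    unfolding flow_of_def using assms finite_arcs by (simp add: root_path_free)
qed

lemma flow_of_unique:
  assumes "\<And>v. v \<in> sources \<Longrightarrow> net src tgt A b v = a v" "\<And>f. f \<in> free_arcs \<Longrightarrow> b f = x f" "e \<in> A"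
  shows "b e = flow_of a x e"
proof (rule flow_eqI[OF _ _ \<open>e \<in> A\<close>])
  show "net src tgt A b v = net src tgt A (flow_of a x) v" if "v \<in> sources" for v
    unfolding net_flow_of[OF that] by (rule assms(1)[OF that])
  show "b f = flow_of a x f" if "f \<in> free_arcs" for f
    unfolding flow_of_free[OF that] by (rule assms(2)[OF that])
qed

end

section \<open>Removing an arc at the first vertex\<close>

text \<open>Arcs into vertices without outgoing arcs play the role of the arcs into the vertex \<open>n + 1\<close>;
  the inner ones form the restriction of the graph to \<open>1, \<dots>, n\<close>. The exponent at \<open>v\<close> is
  \<open>s\<^sub>v = t\<^sub>v + (net flow of b at v)\<close>, for the flow \<open>b\<close> on the inner arcs that is counted by the
  Kostant partition function at \<open>s - t\<close>.\<close>

definition inner_arcs :: "('e \<Rightarrow> nat) \<Rightarrow> ('e \<Rightarrow> nat) \<Rightarrow> 'e set \<Rightarrow> 'e set" where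
  "inner_arcs src tgt A = {e \<in> A. tgt e \<in> src ` A}"

definition flow_exponent :: "('e \<Rightarrow> nat) \<Rightarrow> ('e \<Rightarrow> nat) \<Rightarrow> 'e set \<Rightarrow> ('e \<Rightarrow> nat) \<Rightarrow> nat \<Rightarrow> int" where
  "flow_exponent src tgt A b v =
     int (card {e \<in> A. src e = v}) - 1 + net src tgt (inner_arcs src tgt A) (\<lambda>e. int (b e)) v"

definition exponent_flows :: "('e \<Rightarrow> nat) \<Rightarrow> ('e \<Rightarrow> nat) \<Rightarrow> 'e set \<Rightarrow> ('e \<Rightarrow> nat) set" where
  "exponent_flows src tgt A =
     {b \<in> inner_arcs src tgt A \<rightarrow>\<^sub>E UNIV. \<forall>v\<in>src ` A. 0 \<le> flow_exponent src tgt A b v}"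

text \<open>The Lidskii sum divided by |t|!. It runs over flows, since the recursion acts on single
  flows; grouping them by their exponents will produce the Kostant numbers as fibre sizes.\<close>

definition lidskii_polynomial :: "('e \<Rightarrow> nat) \<Rightarrow> ('e \<Rightarrow> nat) \<Rightarrow> 'e set \<Rightarrow> (nat \<Rightarrow> real) \<Rightarrow> real" where
  "lidskii_polynomial src tgt A a =
     (\<Sum>b\<in>exponent_flows src tgt A. \<Prod>v\<in>src ` A. divided_power (a v) (nat (flow_exponent src tgt A b v)))"

lemma lidskii_polynomial_nonneg:
  "(\<And>v. v \<in> src ` A \<Longrightarrow> 0 \<le> a v) \<Longrightarrow> 0 \<le> lidskii_polynomial src tgt A a"
  unfolding lidskii_polynomial_def by (intro sum_nonneg prod_nonneg divided_power_nonneg) auto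

text \<open>The recursion is stated as insertion of \<open>e\<close> into \<open>A\<close>. As
  \<open>src e\<close> is minimal, no arc of \<open>insert e A\<close> ends there;
  \<open>tgt e\<close> may be a source or a sink of \<open>A\<close>.\<close>

locale first_arc =
  fixes src tgt :: "'e \<Rightarrow> nat" and A :: "'e set" and e :: 'e
  assumes finite_arcs: "finite A"
    and new: "e \<notin> A"
    and src_less_tgt: "f \<in> insert e A \<Longrightarrow> src f < tgt f"
    and src_minimal: "f \<in> A \<Longrightarrow> src e \<le> src f"
begin

abbreviation "i \<equiv> src e"
abbreviation "j \<equiv> tgt e"

lemma src_neq_tgt: "i \<noteq> j" "j \<noteq> i"
  using src_less_tgt[of e] by auto

lemma tgt_neq_src: "f \<in> A \<Longrightarrow> tgt f \<noteq> i"
  using src_less_tgt[of f] src_minimal[of f] by auto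

text \<open>Inserting \<open>e\<close> may create the source \<open>i\<close>, but no arc ends at
  \<open>i\<close>, so only \<open>e\<close> itself can become inner.\<close>

lemma inner_arcs_insert:
  "inner_arcs src tgt (insert e A) =
     (if j \<in> src ` A then insert e (inner_arcs src tgt A) else inner_arcs src tgt A)"
proof -
  have "tgt f \<in> src ` insert e A \<longleftrightarrow> tgt f \<in> src ` A" if "f \<in> insert e A" for f
    using that tgt_neq_src[of f] src_neq_tgt by auto
  then show ?thesis
    unfolding inner_arcs_def by auto
qed

lemma finite_inner: "finite (inner_arcs src tgt A)" and new_inner: "e \<notin> inner_arcs src tgt A"
  using finite_arcs new by (auto simp: inner_arcs_def)

lemma flow_exponent_cong:
  "(\<And>f. f \<in> inner_arcs src tgt B \<Longrightarrow> b f = b' f) \<Longrightarrow>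
    flow_exponent src tgt B b v = flow_exponent src tgt B b' v"
  unfolding flow_exponent_def by (auto intro: net_cong)

lemma flow_exponent_upd: "flow_exponent src tgt A (b(e := k)) v = flow_exponent src tgt A b v"
  using new_inner by (intro flow_exponent_cong) auto

lemma flow_exponent_insert:
  "flow_exponent src tgt (insert e A) b v =
     flow_exponent src tgt A b v + (if v = i then 1 else 0) +
     (if j \<in> src ` A then (if v = i then int (b e) else 0) - (if v = j then int (b e) else 0) else 0)"
proof -
  have "{f \<in> insert e A. src f = v} =
      (if v = i then insert e {f \<in> A. src f = v} else {f \<in> A. src f = v})" by auto
  then have "card {f \<in> insert e A. src f = v} =
      card {f \<in> A. src f = v} + (if v = i then 1 else 0)"
    using finite_arcs new by simp
  then show ?thesis
    unfolding flow_exponent_def inner_arcs_insert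
    by (auto simp: net_insert finite_inner new_inner)
qed

text \<open>Nothing enters \<open>i\<close>, so the flow part of the exponent is nonnegative. Hence
  the sign condition at \<open>i\<close> never restricts the flows, before or after inserting
  \<open>e\<close>.\<close>

lemma flow_exponent_first:
  "flow_exponent src tgt A b i \<ge> -1" "i \<in> src ` A \<Longrightarrow> flow_exponent src tgt A b i \<ge> 0"
proof -
  have "0 \<le> net src tgt (inner_arcs src tgt A) (\<lambda>f. int (b f)) i"
    unfolding net_def by (intro sum_nonneg) (auto simp: tgt_neq_src inner_arcs_def)
  moreover have "card {f \<in> A. src f = i} > 0" if "i \<in> src ` A"
    using that finite_arcs by (auto simp: card_gt_0_iff)
  ultimately show "flow_exponent src tgt A b i \<ge> -1" "i \<in> src ` A \<Longrightarrow> flow_exponent src tgt A b i \<ge> 0"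
    by (auto simp: flow_exponent_def)
qed

lemma flow_exponent_isolated: "i \<notin> src ` A \<Longrightarrow> flow_exponent src tgt A b i = -1"
proof -
  assume i: "i \<notin> src ` A"
  then have "net src tgt (inner_arcs src tgt A) (\<lambda>f. int (b f)) i = 0"
    unfolding net_def by (intro sum.neutral) (auto simp: tgt_neq_src inner_arcs_def image_iff)
  moreover have "{f \<in> A. src f = i} = {}" using i by (auto simp: image_iff)
  ultimately show ?thesis unfolding flow_exponent_def by (simp only: card.empty)
qed

lemma exponent_flows_insert_outer:
  assumes "j \<notin> src ` A"
  shows "exponent_flows src tgt (insert e A) = exponent_flows src tgt A"
proof -
  have "0 \<le> flow_exponent src tgt (insert e A) b i" for b
    using flow_exponent_first(1)[of b] assms by (simp add: flow_exponent_insert)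
  moreover have "0 \<le> flow_exponent src tgt (insert e A) b v \<longleftrightarrow> 0 \<le> flow_exponent src tgt A b v"
    if "v \<in> src ` A" for b v
    using that assms flow_exponent_first(2)[of b] by (cases "v = i") (auto simp: flow_exponent_insert)
  ultimately show ?thesis
    unfolding exponent_flows_def using assms by (auto simp: inner_arcs_insert)
qed

text \<open>Carrying \<open>k\<close> on \<open>e\<close> lowers the exponent at \<open>j\<close> by
  \<open>k\<close> and raises that at \<open>i\<close>; the only constraint on \<open>k\<close> is
  that the exponent at \<open>j\<close> stay nonnegative.\<close>

lemma exponent_flows_insert_inner:
  assumes j: "j \<in> src ` A"
  shows "bij_betw (\<lambda>(b, k). b(e := k))
     (Sigma (exponent_flows src tgt A) (\<lambda>b. {..nat (flow_exponent src tgt A b j)}))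
     (exponent_flows src tgt (insert e A))"
\<comment> \<open>Flows are extensional: forgetting the arc \<open>e\<close> means resetting its
  value to \<open>undefined\<close>.\<close>
proof (rule bij_betw_byWitness[where f' = "\<lambda>b. (b(e := undefined), b e)"])
  let ?I = "inner_arcs src tgt A"
  have I: "inner_arcs src tgt (insert e A) = insert e ?I" using j by (simp add: inner_arcs_insert)
  show "\<forall>a\<in>Sigma (exponent_flows src tgt A) (\<lambda>b. {..nat (flow_exponent src tgt A b j)}).
      (\<lambda>b. (b(e := undefined), b e)) (case a of (b, k) \<Rightarrow> b(e := k)) = a"
    using new_inner by (auto simp: exponent_flows_def PiE_def extensional_def fun_upd_idem_iff)
  show "\<forall>a'\<in>exponent_flows src tgt (insert e A).
      (case (a'(e := undefined), a' e) of (b, k) \<Rightarrow> b(e := k)) = a'" by simp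
  show "(\<lambda>(b, k). b(e := k)) ` Sigma (exponent_flows src tgt A)
      (\<lambda>b. {..nat (flow_exponent src tgt A b j)}) \<subseteq> exponent_flows src tgt (insert e A)"
  proof (clarify)
    fix b k assume b: "b \<in> exponent_flows src tgt A" and k: "k \<le> nat (flow_exponent src tgt A b j)"
    have "0 \<le> flow_exponent src tgt (insert e A) (b(e := k)) v" if "v \<in> src ` insert e A" for v
    proof (cases "v = i")
      case True
      then show ?thesis
        using flow_exponent_first(1)[of b] j src_neq_tgt by (simp add: flow_exponent_insert flow_exponent_upd)
    next
      case False
      then have "v \<in> src ` A" using that by auto
      then have "0 \<le> flow_exponent src tgt A b v" using b unfolding exponent_flows_def by blast
      then show ?thesis using False k j by (auto simp: flow_exponent_insert flow_exponent_upd)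
    qed
    moreover have "b(e := k) \<in> insert e ?I \<rightarrow>\<^sub>E UNIV"
      using b by (auto simp: exponent_flows_def PiE_def extensional_def)
    ultimately show "b(e := k) \<in> exponent_flows src tgt (insert e A)"
      unfolding exponent_flows_def I by simp
  qed
  show "(\<lambda>b. (b(e := undefined), b e)) ` exponent_flows src tgt (insert e A)
     \<subseteq> Sigma (exponent_flows src tgt A) (\<lambda>b. {..nat (flow_exponent src tgt A b j)})"
  proof (clarify)
    fix b assume b: "b \<in> exponent_flows src tgt (insert e A)"
    have nn: "0 \<le> flow_exponent src tgt A b v" if "v \<in> src ` A" for v
    proof (cases "v = i")
      case True
      then show ?thesis using flow_exponent_first(2)[of b] that by simp
    next
      case False
      moreover have "0 \<le> flow_exponent src tgt (insert e A) b v"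
        using b that unfolding exponent_flows_def by blast
      ultimately show ?thesis using j by (auto simp: flow_exponent_insert split: if_splits)
    qed
    have "0 \<le> flow_exponent src tgt (insert e A) b j"
      using b j unfolding exponent_flows_def by blast
    then have "b e \<le> nat (flow_exponent src tgt A b j)"
      using j src_neq_tgt by (auto simp: flow_exponent_insert)
    moreover have "b(e := undefined) \<in> ?I \<rightarrow>\<^sub>E UNIV"
      using b unfolding exponent_flows_def I by (auto simp: PiE_def extensional_def)
    ultimately show "b(e := undefined) \<in> exponent_flows src tgt A \<and>
        b e \<in> {..nat (flow_exponent src tgt A (b(e := undefined)) j)}"
      using nn by (auto simp: exponent_flows_def flow_exponent_upd)
  qed
qed

lemma finite_exponent_flows_insert:
  "finite (exponent_flows src tgt A) \<Longrightarrow> finite (exponent_flows src tgt (insert e A))"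
  using bij_betw_finite[OF exponent_flows_insert_inner] exponent_flows_insert_outer
  by (cases "j \<in> src ` A") auto

lemma sum_exponent_flows_insert:
  assumes "finite (exponent_flows src tgt A)" and j: "j \<in> src ` A"
  shows "(\<Sum>b\<in>exponent_flows src tgt (insert e A). g b) =
    (\<Sum>b\<in>exponent_flows src tgt A. \<Sum>k\<le>nat (flow_exponent src tgt A b j). g (b(e := k)))"
proof -
  have "(\<Sum>b\<in>exponent_flows src tgt A. \<Sum>k\<le>nat (flow_exponent src tgt A b j). g (b(e := k))) =
    (\<Sum>(b, k)\<in>Sigma (exponent_flows src tgt A) (\<lambda>b. {..nat (flow_exponent src tgt A b j)}). g (b(e := k)))"
    using assms(1) by (subst sum.Sigma) auto
  also have "\<dots> = (\<Sum>b\<in>exponent_flows src tgt (insert e A). g b)"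
    using sum.reindex_bij_betw[OF exponent_flows_insert_inner[OF j], of g]
    by (simp add: case_prod_unfold)
  finally show ?thesis by simp
qed

lemma flow_exponent_insert_upd:
  "j \<in> src ` A \<Longrightarrow> flow_exponent src tgt (insert e A) (b(e := k)) v =
     flow_exponent src tgt A b v + (if v = i then 1 + int k else 0) - (if v = j then int k else 0)"
  by (simp add: flow_exponent_insert flow_exponent_upd)

end

section \<open>Recursion of the Lidskii polynomial\<close>

context first_arc
begin

text \<open>The exponent at \<open>i\<close> is -1 + 1 = 0: the flow forced onto \<open>e\<close>
  disappears into a sink, so the factor of \<open>a i\<close> is 1.\<close>

lemma lidskii_polynomial_insert_isolated_outer:
  assumes i: "i \<notin> src ` A" and j: "j \<notin> src ` A"
  shows "lidskii_polynomial src tgt (insert e A) a = lidskii_polynomial src tgt A a"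
  unfolding lidskii_polynomial_def exponent_flows_insert_outer[OF j]
proof (intro sum.cong refl)
  fix b
  have "(\<Prod>v\<in>src ` insert e A. divided_power (a v) (nat (flow_exponent src tgt (insert e A) b v))) =
     divided_power (a i) (nat (flow_exponent src tgt (insert e A) b i)) *
     (\<Prod>v\<in>src ` A. divided_power (a v) (nat (flow_exponent src tgt (insert e A) b v)))"
    using i finite_arcs by simp
  also have "divided_power (a i) (nat (flow_exponent src tgt (insert e A) b i)) = 1"
    using flow_exponent_isolated[OF i, of b] j by (simp add: flow_exponent_insert divided_power_def)
  also have "(\<Prod>v\<in>src ` A. divided_power (a v) (nat (flow_exponent src tgt (insert e A) b v))) =
      (\<Prod>v\<in>src ` A. divided_power (a v) (nat (flow_exponent src tgt A b v)))"
    using i j by (intro prod.cong) (auto simp: flow_exponent_insert image_iff)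
  finally show "(\<Prod>v\<in>src ` insert e A. divided_power (a v) (nat (flow_exponent src tgt (insert e A) b v))) =
      (\<Prod>v\<in>src ` A. divided_power (a v) (nat (flow_exponent src tgt A b v)))" by simp
qed

text \<open>With flow k on \<open>e\<close> the exponent is -1 + 1 + k = k at \<open>i\<close> and
  drops by k at \<open>j\<close>; the sum over k is the convolution in
  \<open>divided_power_add\<close>.\<close>

lemma lidskii_polynomial_insert_isolated_inner:
  assumes i: "i \<notin> src ` A" and j: "j \<in> src ` A" and fin: "finite (exponent_flows src tgt A)"
  shows "lidskii_polynomial src tgt (insert e A) a = lidskii_polynomial src tgt A (a(j := a i + a j))"
  unfolding lidskii_polynomial_def sum_exponent_flows_insert[OF fin j]
proof (intro sum.cong refl)
  fix b
  let ?x = "flow_exponent src tgt A b" and ?x' = "\<lambda>k. flow_exponent src tgt (insert e A) (b(e := k))"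
  define c where "c = (\<Prod>v\<in>src ` A - {j}. divided_power (a v) (nat (?x v)))"
  have S: "src ` insert e A = insert i (insert j (src ` A - {j}))" "src ` A = insert j (src ` A - {j})"
    using j by auto
  have "(\<Prod>v\<in>src ` insert e A. divided_power (a v) (nat (?x' k v))) =
     divided_power (a i) k * divided_power (a j) (nat (?x j) - k) * c" for k
  proof -
    have "(\<Prod>v\<in>src ` A - {j}. divided_power (a v) (nat (?x' k v))) = c"
      unfolding c_def using i j by (intro prod.cong) (auto simp: flow_exponent_insert_upd image_iff)
    moreover have "nat (?x' k i) = k" "nat (?x' k j) = nat (?x j) - k"
      using flow_exponent_isolated[OF i, of b] j src_neq_tgt by (auto simp: flow_exponent_insert_upd nat_diff_distrib')
    ultimately show ?thesis
      unfolding S(1) using i j finite_arcs src_neq_tgt by (subst prod.insert, force, force)+ simp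
  qed
  moreover have "(\<Prod>v\<in>src ` A. divided_power ((a(j := a i + a j)) v) (nat (?x v))) =
      divided_power (a i + a j) (nat (?x j)) * c"
    unfolding c_def using finite_arcs j by (subst prod.remove[of _ j]) auto
  ultimately show "(\<Sum>k\<le>nat (?x j). \<Prod>v\<in>src ` insert e A. divided_power (a v) (nat (?x' k v))) =
      (\<Prod>v\<in>src ` A. divided_power ((a(j := a i + a j)) v) (nat (?x v)))"
    by (simp add: divided_power_add sum_distrib_right)
qed

text \<open>The differentiated polynomial is the volume of the slice on which arc \<open>e\<close> carries the flow \<open>y\<close>.\<close>

lemma lidskii_polynomial_insert_antiderivative:
  assumes i: "i \<in> src ` A" and fin: "finite (exponent_flows src tgt A)"
  shows "\<exists>F. (\<forall>y. (F has_real_derivative lidskii_polynomial src tgt A (a(i := a i - y, j := a j + y))) (at y))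
     \<and> F (a i) - F 0 = lidskii_polynomial src tgt (insert e A) a"
proof -
  let ?x = "flow_exponent src tgt A"
  let ?V = "src ` A"
  define p where "p b = nat (?x b i)" for b
  \<comment> \<open>A sink \<open>j\<close> has no factor in the product; index 0 gives the factor 1
    and lets both kinds of target share one formula.\<close>
  define q where "q b = (if j \<in> ?V then nat (?x b j) else 0)" for b
  define c where "c b = (\<Prod>v\<in>?V - {i, j}. divided_power (a v) (nat (?x b v)))" for b
  define h where "h b y = - (\<Sum>k\<le>q b. divided_power (a i - y) (p b + 1 + k) * divided_power (a j + y) (q b - k))"
    for b y
  define F where "F y = (\<Sum>b\<in>exponent_flows src tgt A. c b * h b y)" for y
  have S: "src ` insert e A = ?V" using i by auto
  have split: "(\<Prod>v\<in>?V. g v) = g i * (if j \<in> ?V then g j else 1) * (\<Prod>v\<in>?V - {i, j}. g v)"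
    for g :: "nat \<Rightarrow> real"
  proof -
    have "(\<Prod>v\<in>?V. g v) = g i * (\<Prod>v\<in>?V - {i}. g v)"
      using i finite_arcs by (subst prod.remove[of _ i]) auto
    also have "(\<Prod>v\<in>?V - {i}. g v) = (if j \<in> ?V then g j else 1) * (\<Prod>v\<in>?V - {i} - {j}. g v)"
      using finite_arcs src_neq_tgt by (auto simp: prod.remove[of _ j])
    also have "?V - {i} - {j} = ?V - {i, j}" by auto
    finally show ?thesis by simp
  qed
  have "(F has_real_derivative lidskii_polynomial src tgt A (a(i := a i - y, j := a j + y))) (at y)" for y
  proof -
    have "(\<Prod>v\<in>?V. divided_power ((a(i := a i - y, j := a j + y)) v) (nat (?x b v))) =
        c b * (divided_power (a i - y) (p b) * divided_power (a j + y) (q b))" for b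
    proof -
      have "(\<Prod>v\<in>?V - {i, j}. divided_power ((a(i := a i - y, j := a j + y)) v) (nat (?x b v))) = c b"
        unfolding c_def by (intro prod.cong) auto
      then show ?thesis
        unfolding split p_def q_def using src_neq_tgt by (auto simp: divided_power_def[of _ 0])
    qed
    moreover have "(h b has_real_derivative divided_power (a i - y) (p b) * divided_power (a j + y) (q b)) (at y)"
      for b
      unfolding h_def by (rule has_real_derivative_transfer_divided_power)
    ultimately show ?thesis
      unfolding F_def lidskii_polynomial_def by (auto intro!: DERIV_sum DERIV_cmult)
  qed
  moreover have "F (a i) - F 0 = lidskii_polynomial src tgt (insert e A) a"
  proof -
    \<comment> \<open>All indices \<open>p b + 1 + k\<close> are positive, so at
      \<open>y = a i\<close> every summand contains a positive power of 0.\<close>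
    have "h b (a i) = 0" for b by (simp add: h_def divided_power_def)
    then have "F (a i) - F 0 = (\<Sum>b\<in>exponent_flows src tgt A. c b * - h b 0)"
      by (simp add: F_def sum_negf)
    also have "\<dots> = lidskii_polynomial src tgt (insert e A) a"
    proof (cases "j \<in> ?V")
      case True
      have "(\<Prod>v\<in>?V. divided_power (a v) (nat (flow_exponent src tgt (insert e A) (b(e := k)) v))) =
          c b * (divided_power (a i) (p b + 1 + k) * divided_power (a j) (q b - k))" for b k
      proof -
        have "(\<Prod>v\<in>?V - {i, j}. divided_power (a v) (nat (flow_exponent src tgt (insert e A) (b(e := k)) v))) = c b"
          unfolding c_def using True by (intro prod.cong) (auto simp: flow_exponent_insert_upd)
        moreover have "nat (flow_exponent src tgt (insert e A) (b(e := k)) i) = p b + 1 + k"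
          using True src_neq_tgt flow_exponent_first(2)[OF i, of b]
          by (simp add: p_def flow_exponent_insert_upd)
        moreover have "nat (flow_exponent src tgt (insert e A) (b(e := k)) j) = q b - k"
          using True src_neq_tgt by (simp add: q_def flow_exponent_insert_upd nat_diff_distrib')
        ultimately show ?thesis unfolding split using True by simp
      qed
      then show ?thesis
        unfolding lidskii_polynomial_def S sum_exponent_flows_insert[OF fin True]
        by (simp add: h_def q_def True sum_distrib_left)
    next
      case False
      have "(\<Prod>v\<in>?V. divided_power (a v) (nat (flow_exponent src tgt (insert e A) b v))) =
          c b * divided_power (a i) (p b + 1)" for b
      proof -
        have "(\<Prod>v\<in>?V - {i, j}. divided_power (a v) (nat (flow_exponent src tgt (insert e A) b v))) = c b"
          unfolding c_def using False by (intro prod.cong) (auto simp: flow_exponent_insert)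
        moreover have "nat (flow_exponent src tgt (insert e A) b i) = p b + 1"
          using False flow_exponent_first(2)[OF i, of b] by (simp add: p_def flow_exponent_insert)
        ultimately show ?thesis unfolding split using False by simp
      qed
      then show ?thesis
        unfolding lidskii_polynomial_def S exponent_flows_insert_outer[OF False]
        by (simp add: h_def q_def False divided_power_def[of _ 0])
    qed
    finally show ?thesis .
  qed
  ultimately show ?thesis by blast
qed

end

section \<open>The volume in tree coordinates\<close>

text \<open>The projection of the flow polytope to the coordinates \<open>N\<close>. Leaving the
  forced flows existential lets arcs be removed without formulas for them.\<close>

definition flow_cell :: "('e \<Rightarrow> nat) \<Rightarrow> ('e \<Rightarrow> nat) \<Rightarrow> 'e set \<Rightarrow> 'e set \<Rightarrow> (nat \<Rightarrow> real) \<Rightarrow> ('e \<Rightarrow> real) set" where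
  "flow_cell src tgt A N a =
     {x \<in> N \<rightarrow>\<^sub>E UNIV. \<exists>b. (\<forall>e\<in>A. 0 \<le> b e) \<and> (\<forall>v\<in>src ` A. net src tgt A b v = a v) \<and> (\<forall>f\<in>N. b f = x f)}"

section \<open>Slices of the flow cell along an arc at the first vertex\<close>

context first_arc
begin

text \<open>A prescribed flow \<open>y\<close> on \<open>e\<close> can be moved into the data: it
  leaves \<open>i\<close> and arrives at \<open>j\<close>. If \<open>j\<close> is a sink, the change
  of \<open>a\<close> there is not seen, as only values at sources enter.\<close>

lemma fun_upd_in_flow_cell_insert:
  assumes i: "i \<in> src ` A" and N: "e \<notin> N" and x: "x \<in> N \<rightarrow>\<^sub>E UNIV"
  shows "x(e := y) \<in> flow_cell src tgt (insert e A) (insert e N) a \<longleftrightarrow>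
     0 \<le> y \<and> x \<in> flow_cell src tgt A N (a(i := a i - y, j := a j + y))"
proof -
  have S: "src ` insert e A = src ` A" using i by auto
  have mem: "x(e := y) \<in> insert e N \<rightarrow>\<^sub>E UNIV" using x by (auto simp: PiE_def extensional_def)
  show ?thesis
  proof
    assume "x(e := y) \<in> flow_cell src tgt (insert e A) (insert e N) a"
    then obtain b where b: "\<forall>f\<in>insert e A. 0 \<le> b f"
      "\<forall>v\<in>src ` A. net src tgt (insert e A) b v = a v" "\<forall>f\<in>insert e N. b f = (x(e := y)) f"
      by (auto simp: flow_cell_def S)
    have "net src tgt A b v = (a(i := a i - y, j := a j + y)) v" if "v \<in> src ` A" for v
      using b(2)[rule_format, OF that] b(3)[rule_format, of e] src_neq_tgt
      by (auto simp: net_insert[OF finite_arcs new] split: if_splits)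
    moreover have "\<forall>f\<in>N. b f = x f"
    proof
      fix f assume "f \<in> N"
      then have "f \<noteq> e" "b f = (x(e := y)) f" using b(3) N by blast+
      then show "b f = x f" by simp
    qed
    ultimately show "0 \<le> y \<and> x \<in> flow_cell src tgt A N (a(i := a i - y, j := a j + y))"
      unfolding flow_cell_def using x b(1) b(3)[rule_format, of e] by (intro conjI CollectI exI[of _ b]) simp_all
  next
    assume R: "0 \<le> y \<and> x \<in> flow_cell src tgt A N (a(i := a i - y, j := a j + y))"
    then obtain b where b: "\<forall>f\<in>A. 0 \<le> b f"
      "\<forall>v\<in>src ` A. net src tgt A b v = (a(i := a i - y, j := a j + y)) v" "\<forall>f\<in>N. b f = x f"
      unfolding flow_cell_def by blast
    have nb: "net src tgt A (b(e := y)) v = net src tgt A b v" for v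
      using new by (intro net_cong) auto
    have "net src tgt (insert e A) (b(e := y)) v = a v" if "v \<in> src ` A" for v
      using b(2)[rule_format, OF that] src_neq_tgt
      by (auto simp: net_insert[OF finite_arcs new] nb split: if_splits)
    moreover have "\<forall>f\<in>insert e A. 0 \<le> (b(e := y)) f" using b R by auto
    moreover have "\<forall>f\<in>insert e N. (b(e := y)) f = (x(e := y)) f" using b by auto
    ultimately show "x(e := y) \<in> flow_cell src tgt (insert e A) (insert e N) a"
      using mem unfolding flow_cell_def S by blast
  qed
qed

text \<open>No arc enters \<open>i\<close>, so its net flow is a sum of nonnegative terms. This is
  what ends the integration at \<open>y = a i\<close>.\<close>

lemma flow_cell_negative:
  assumes i: "i \<in> src ` A" and "a i < 0"
  shows "flow_cell src tgt A N a = {}"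
proof -
  have "net src tgt A b i \<ge> 0" if "\<forall>f\<in>A. 0 \<le> b f" for b :: "'e \<Rightarrow> real"
    unfolding net_def using that by (intro sum_nonneg) (auto simp: tgt_neq_src)
  then have "\<not> (\<forall>v\<in>src ` A. net src tgt A b v = a v)" if "\<forall>f\<in>A. 0 \<le> b f" for b :: "'e \<Rightarrow> real"
    using assms that by (metis not_less)
  then show ?thesis unfolding flow_cell_def by blast
qed

text \<open>As \<open>e\<close> is the only arc at \<open>i\<close>, the conservation law there
  reads \<open>b e = a i\<close>; the vertex is eliminated together with its arc, and the
  coordinates \<open>N\<close> stay.\<close>

lemma flow_cell_insert_isolated:
  assumes i: "i \<notin> src ` A" and N: "e \<notin> N" and "0 \<le> a i"
  shows "flow_cell src tgt (insert e A) N a = flow_cell src tgt A N (a(j := a i + a j))"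
proof -
  have S: "src ` insert e A = insert i (src ` A)" by auto
  have net_i: "net src tgt A b i = 0" for b :: "'e \<Rightarrow> real"
    unfolding net_def using i by (intro sum.neutral) (auto simp: tgt_neq_src image_iff)
  show ?thesis
  proof (intro set_eqI iffI)
    fix x assume "x \<in> flow_cell src tgt (insert e A) N a"
    then obtain b where x: "x \<in> N \<rightarrow>\<^sub>E UNIV" and b: "\<forall>f\<in>insert e A. 0 \<le> b f"
      "\<forall>v\<in>insert i (src ` A). net src tgt (insert e A) b v = a v" "\<forall>f\<in>N. b f = x f"
      unfolding flow_cell_def S by blast
    have e: "b e = a i"
      using b(2) net_i[of b] src_neq_tgt by (simp add: net_insert[OF finite_arcs new])
    have "net src tgt A b v = (a(j := a i + a j)) v" if "v \<in> src ` A" for v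
    proof -
      have "net src tgt (insert e A) b v = a v" "v \<noteq> i" using b(2) that i by blast+
      then show ?thesis using e by (auto simp: net_insert[OF finite_arcs new] split: if_splits)
    qed
    then show "x \<in> flow_cell src tgt A N (a(j := a i + a j))"
      unfolding flow_cell_def using x b by blast
  next
    fix x assume "x \<in> flow_cell src tgt A N (a(j := a i + a j))"
    then obtain b where x: "x \<in> N \<rightarrow>\<^sub>E UNIV" and b: "\<forall>f\<in>A. 0 \<le> b f"
      "\<forall>v\<in>src ` A. net src tgt A b v = (a(j := a i + a j)) v" "\<forall>f\<in>N. b f = x f"
      unfolding flow_cell_def by blast
    let ?b = "b(e := a i)"
    have nb: "net src tgt A ?b v = net src tgt A b v" for v
      using new by (intro net_cong) auto
    have "net src tgt (insert e A) ?b v = a v" if "v \<in> insert i (src ` A)" for v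
    proof (cases "v = i")
      case True
      then show ?thesis using src_neq_tgt by (simp add: net_insert[OF finite_arcs new] nb net_i)
    next
      case False
      then have "net src tgt A b v = (a(j := a i + a j)) v" using that b(2) by blast
      then show ?thesis using False by (auto simp: net_insert[OF finite_arcs new] nb)
    qed
    moreover have "\<forall>f\<in>insert e A. 0 \<le> ?b f" using b assms by auto
    moreover have "\<forall>f\<in>N. ?b f = x f" using b N by auto
    ultimately show "x \<in> flow_cell src tgt (insert e A) N a"
      unfolding flow_cell_def S using x by blast
  qed
qed

end

text \<open>Uniqueness of the flow with given free coordinates removes the existential. The cell is
  then cut out by finitely many affine inequalities, which gives measurability.\<close>

lemma (in rooted_arcs) flow_cell_eq:
  "flow_cell src tgt A free_arcs a = {x \<in> free_arcs \<rightarrow>\<^sub>E UNIV. \<forall>e\<in>A. 0 \<le> flow_of a x e}"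
proof (intro set_eqI iffI)
  fix x assume "x \<in> flow_cell src tgt A free_arcs a"
  then obtain b where x: "x \<in> free_arcs \<rightarrow>\<^sub>E UNIV" and b: "\<forall>e\<in>A. 0 \<le> b e"
    "\<forall>v\<in>sources. net src tgt A b v = a v" "\<forall>f\<in>free_arcs. b f = x f"
    unfolding flow_cell_def by blast
  have "b e = flow_of a x e" if "e \<in> A" for e
    using b(2,3) that by (intro flow_of_unique) blast+
  with x b(1) show "x \<in> {x \<in> free_arcs \<rightarrow>\<^sub>E UNIV. \<forall>e\<in>A. 0 \<le> flow_of a x e}"
    by simp
next
  fix x assume "x \<in> {x \<in> free_arcs \<rightarrow>\<^sub>E UNIV. \<forall>e\<in>A. 0 \<le> flow_of a x e}"
  then show "x \<in> flow_cell src tgt A free_arcs a"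
    unfolding flow_cell_def
    by (intro CollectI conjI exI[of _ "flow_of a x"] ballI) (simp_all only: mem_Collect_eq net_flow_of flow_of_free)
qed

lemma (in rooted_arcs) flow_cell_in_sets:
  "flow_cell src tgt A free_arcs a \<in> sets (\<Pi>\<^sub>M f\<in>free_arcs. lborel)"
proof -
  have comp: "(\<lambda>x. x f) \<in> borel_measurable (\<Pi>\<^sub>M f\<in>free_arcs. lborel :: real measure)" if "f \<in> free_arcs" for f
    using measurable_component_singleton[OF that, of "\<lambda>_. lborel :: real measure"] by simp
  have [measurable]: "(\<lambda>x. flow_of a x e) \<in> borel_measurable (\<Pi>\<^sub>M f\<in>free_arcs. lborel)" for e
    unfolding flow_of_def
    by (intro borel_measurable_add borel_measurable_const borel_measurable_sum borel_measurable_times comp)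
  have "{x \<in> space (\<Pi>\<^sub>M f\<in>free_arcs. lborel). \<forall>e\<in>A. 0 \<le> flow_of a x e} \<in> sets (\<Pi>\<^sub>M f\<in>free_arcs. lborel)"
    using finite_arcs by measurable
  then show ?thesis by (simp add: flow_cell_eq space_PiM)
qed

text \<open>\<open>a\<close> is general because cutting an arc changes it. Finiteness of the set of
  flows is proved along, since the recursion of the polynomial rearranges sums over it.\<close>

lemma emeasure_flow_cell:
  assumes "rooted_arcs src tgt A \<tau>" and "\<And>v. v \<in> src ` A \<Longrightarrow> 0 \<le> a v"
  shows "finite (exponent_flows src tgt A) \<and>
    emeasure (\<Pi>\<^sub>M f\<in>A - \<tau> ` src ` A. lborel) (flow_cell src tgt A (A - \<tau> ` src ` A) a) =
      ennreal (lidskii_polynomial src tgt A a)"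
  using assms
proof (induction "card A" arbitrary: A \<tau> a rule: less_induct)
  case less
  interpret rooted_arcs src tgt A \<tau> by fact
  show ?case
  proof (cases "A = {}")
    case True
    \<comment> \<open>Without arcs the coordinate space is a single point of measure 1, and the
      polynomial is an empty product.\<close>
    have "flow_cell src tgt A {} a = {\<lambda>_. undefined}" by (auto simp: True flow_cell_def)
    then show ?thesis
      by (simp add: True exponent_flows_def inner_arcs_def lidskii_polynomial_def PiM_empty)
  next
    case False
    define i where "i = Min (src ` A)"
    have i: "i \<in> src ` A" unfolding i_def using False finite_arcs by (intro Min_in) auto
    have i_min: "i \<le> src f" if "f \<in> A" for f unfolding i_def using that finite_arcs by simp
    have step: "first_arc src tgt (A - {e}) e \<and> insert e (A - {e}) = A \<and> card (A - {e}) < card A"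
      if "e \<in> A" "src e = i" for e
      using that finite_arcs i_min src_less_tgt card_Diff1_less[OF finite_arcs that(1)]
      by (auto simp: first_arc_def insert_absorb)
    \<comment> \<open>The same choice \<open>\<tau>\<close> serves after the deletion as long as
      \<open>e\<close> is not chosen at a remaining source.\<close>
    have rooted: "rooted_arcs src tgt (A - {e}) \<tau>" if "e \<notin> \<tau> ` src ` (A - {e})" for e
    proof
      show "\<tau> v \<in> A - {e}" "src (\<tau> v) = v" if "v \<in> src ` (A - {e})" for v
      proof -
        have "v \<in> src ` A" "\<tau> v \<noteq> e" using that \<open>e \<notin> \<tau> ` src ` (A - {e})\<close> by auto
        then show "\<tau> v \<in> A - {e}" "src (\<tau> v) = v" by (simp_all add: root_in src_root)
      qed
    qed (use finite_arcs src_less_tgt in auto)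
    show ?thesis
    proof (cases "\<exists>e\<in>A. src e = i \<and> e \<noteq> \<tau> i")
      case True
      then obtain e where e: "e \<in> A" "src e = i" "e \<noteq> \<tau> i" by auto
      define B where "B = A - {e}"
      interpret B: first_arc src tgt B e using step[OF e(1,2)] by (simp add: B_def)
      have A: "A = insert e B" and card: "card B < card A" using step[OF e(1,2)] unfolding B_def by simp_all
      have iB: "src e \<in> src ` B"
        using root_in[OF i] src_root[OF i] e by (intro image_eqI[of _ _ "\<tau> i"]) (auto simp: B_def)
      then have S: "src ` A = src ` B" unfolding A by auto
      have "e \<notin> \<tau> ` src ` A" using e src_root by auto
      then have rB: "rooted_arcs src tgt B \<tau>" unfolding B_def by (intro rooted) auto
      interpret RB: rooted_arcs src tgt B \<tau> by fact
      define N where "N = B - \<tau> ` src ` B"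
      have N: "A - \<tau> ` src ` A = insert e N" "e \<notin> N" "finite N"
        using \<open>e \<notin> \<tau> ` src ` A\<close> finite_arcs e(1) unfolding N_def S[symmetric] by (auto simp: B_def)
      define a' where "a' y = a(src e := a (src e) - y, tgt e := a (tgt e) + y)" for y
      have a'_nonneg: "0 \<le> a' y v" if "v \<in> src ` B" "y \<in> {0..a (src e)}" for v y
        using that less.prems(2)[of v] by (auto simp: a'_def S)
      \<comment> \<open>Finiteness is taken from the instance with net flow 0, whose sign hypothesis
        is trivial.\<close>
      have IH: "finite (exponent_flows src tgt B)"
        "y \<in> {0..a (src e)} \<Longrightarrow> emeasure (\<Pi>\<^sub>M f\<in>N. lborel) (flow_cell src tgt B N (a' y)) =
          ennreal (lidskii_polynomial src tgt B (a' y))" for y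
        using less.hyps[OF card rB, of "\<lambda>_. 0"] less.hyps[OF card rB, of "a' y"] a'_nonneg
        by (auto simp: N_def)
      obtain F where F: "\<And>y. (F has_real_derivative lidskii_polynomial src tgt B (a' y)) (at y)"
        "F (a (src e)) - F 0 = lidskii_polynomial src tgt A a"
        using B.lidskii_polynomial_insert_antiderivative[OF iB IH(1), of a] unfolding A a'_def by blast
      interpret product_sigma_finite "\<lambda>_ :: 'a. lborel :: real measure" by unfold_locales
      have meas: "flow_cell src tgt A (insert e N) a \<in> sets (\<Pi>\<^sub>M f\<in>insert e N. lborel)"
        using flow_cell_in_sets[of a] by (simp add: N)
      have measB: "flow_cell src tgt B N b \<in> sets (\<Pi>\<^sub>M f\<in>N. lborel)" for b
        using RB.flow_cell_in_sets[of b] by (simp add: N_def)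
      \<comment> \<open>For \<open>y < 0\<close> the coordinate \<open>e\<close> itself is negative,
        for \<open>y > a (src e)\<close> the remaining cell is empty; hence the indicator of the
        interval.\<close>
      have slice: "(\<integral>\<^sup>+ x. indicator (flow_cell src tgt A (insert e N) a) (x(e := y)) \<partial>(\<Pi>\<^sub>M f\<in>N. lborel)) =
          ennreal (lidskii_polynomial src tgt B (a' y)) * indicator {0..a (src e)} y" for y
      proof -
        have "(\<integral>\<^sup>+ x. indicator (flow_cell src tgt A (insert e N) a) (x(e := y)) \<partial>(\<Pi>\<^sub>M f\<in>N. lborel)) =
          (\<integral>\<^sup>+ x. indicator {0..} y * indicator (flow_cell src tgt B N (a' y)) x \<partial>(\<Pi>\<^sub>M f\<in>N. lborel))"
        proof (intro nn_integral_cong)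
          fix x assume "x \<in> space (\<Pi>\<^sub>M f\<in>N. lborel :: real measure)"
          then have "x \<in> N \<rightarrow>\<^sub>E UNIV" by (simp add: space_PiM)
          from B.fun_upd_in_flow_cell_insert[OF iB N(2) this, of y a]
          show "indicator (flow_cell src tgt A (insert e N) a) (x(e := y)) =
            (indicator {0..} y * indicator (flow_cell src tgt B N (a' y)) x :: ennreal)"
            by (auto simp: A a'_def indicator_def)
        qed
        also have "\<dots> = indicator {0..} y * emeasure (\<Pi>\<^sub>M f\<in>N. lborel) (flow_cell src tgt B N (a' y))"
          using measB by (simp add: nn_integral_cmult)
        also have "\<dots> = ennreal (lidskii_polynomial src tgt B (a' y)) * indicator {0..a (src e)} y"
        proof (cases "y \<le> a (src e)")
          case True
          then show ?thesis using IH(2)[of y] by (auto simp: indicator_def)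
        next
          case False
          then have "flow_cell src tgt B N (a' y) = {}"
            using iB B.src_neq_tgt by (intro B.flow_cell_negative) (auto simp: a'_def)
          then show ?thesis using False by simp
        qed
        finally show ?thesis .
      qed
      have "emeasure (\<Pi>\<^sub>M f\<in>insert e N. lborel) (flow_cell src tgt A (insert e N) a) =
          (\<integral>\<^sup>+ y. (\<integral>\<^sup>+ x. indicator (flow_cell src tgt A (insert e N) a) (x(e := y)) \<partial>(\<Pi>\<^sub>M f\<in>N. lborel)) \<partial>lborel)"
        using meas N by (simp flip: nn_integral_indicator add: product_nn_integral_insert_rev)
      also have "\<dots> = (\<integral>\<^sup>+ y. ennreal (lidskii_polynomial src tgt B (a' y)) * indicator {0..a (src e)} y \<partial>lborel)"
        by (simp add: slice)
      also have "\<dots> = ennreal (F (a (src e)) - F 0)"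
      proof (rule nn_integral_FTC_Icc)
        show "(\<lambda>y. lidskii_polynomial src tgt B (a' y)) \<in> borel_measurable borel"
          unfolding lidskii_polynomial_def divided_power_def a'_def fun_upd_def by measurable
        show "0 \<le> a (src e)" using less.prems(2) iB S by auto
      qed (use F a'_nonneg in \<open>auto intro!: lidskii_polynomial_nonneg\<close>)
      finally show ?thesis
        using B.finite_exponent_flows_insert[OF IH(1), folded A] by (simp add: F N)
    next
      case False
      \<comment> \<open>Now \<open>\<tau> i\<close> is the only arc at \<open>i\<close>: arc and
        source disappear together, and the free arcs stay the same.\<close>
      define e where "e = \<tau> i"
      have e: "e \<in> A" "src e = i" unfolding e_def by (rule root_in[OF i], rule src_root[OF i])
      define B where "B = A - {e}"
      interpret B: first_arc src tgt B e using step[OF e(1,2)] by (simp add: B_def)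
      have A: "A = insert e B" and card: "card B < card A" using step[OF e(1,2)] unfolding B_def by simp_all
      have iB: "src e \<notin> src ` B" using False unfolding B_def e(2) by (auto simp flip: e_def)
      have "e \<notin> \<tau> ` src ` B"
      proof
        assume "e \<in> \<tau> ` src ` B"
        then obtain v where "v \<in> src ` B" "e = \<tau> v" by auto
        moreover from this have "src (\<tau> v) = v" unfolding A by (intro src_root) (simp add: A)
        ultimately show False using iB by simp
      qed
      then have rB: "rooted_arcs src tgt B \<tau>" unfolding B_def by (intro rooted) auto
      have "src ` A = insert i (src ` B)" unfolding A by (simp add: e(2))
      then have N: "A - \<tau> ` src ` A = B - \<tau> ` src ` B" unfolding B_def by (auto simp flip: e_def)
      have nn: "0 \<le> a (src e)" using less.prems(2) e by auto
      define a' where "a' = a(tgt e := a (src e) + a (tgt e))"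
      have "0 \<le> a' v" if "v \<in> src ` B" for v
        using that nn less.prems(2)[of v] by (auto simp: a'_def A)
      note IH = less.hyps[OF card rB, of a', OF this]
      have poly: "lidskii_polynomial src tgt A a = lidskii_polynomial src tgt B a'"
      proof (cases "tgt e \<in> src ` B")
        case True
        then show ?thesis
          using B.lidskii_polynomial_insert_isolated_inner[OF iB _ conjunct1[OF IH]] unfolding A a'_def by blast
      next
        case False
        have "lidskii_polynomial src tgt A a = lidskii_polynomial src tgt B a"
          unfolding A by (rule B.lidskii_polynomial_insert_isolated_outer[OF iB False])
        also have "\<dots> = lidskii_polynomial src tgt B a'"
          unfolding lidskii_polynomial_def a'_def using False
          by (intro sum.cong prod.cong) (auto simp: image_iff)
        finally show ?thesis .
      qed
      have "flow_cell src tgt A (B - \<tau> ` src ` B) a = flow_cell src tgt B (B - \<tau> ` src ` B) a'"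
        using B.flow_cell_insert_isolated[of "B - \<tau> ` src ` B" a, OF iB _ nn] B.new unfolding A a'_def by blast
      then show ?thesis
        using IH B.finite_exponent_flows_insert[OF conjunct1[OF IH], folded A] unfolding N poly by simp
    qed
  qed
qed

section \<open>Unimodular changes of coordinates\<close>

abbreviation lborel_fun :: "'i set \<Rightarrow> ('i \<Rightarrow> real) measure" where
  "lborel_fun J \<equiv> (\<Pi>\<^sub>M i\<in>J. lborel)"

lemma space_lborel_fun: "space (lborel_fun J) = J \<rightarrow>\<^sub>E UNIV"
  by (simp add: space_PiM)

lemma measurable_lborel_fun_component [measurable]:
  "i \<in> J \<Longrightarrow> (\<lambda>x. x i) \<in> borel_measurable (lborel_fun J)"
  using measurable_component_singleton[of i J "\<lambda>_. lborel :: real measure"] by simp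

lemma measurable_into_lborel_fun:
  assumes "\<And>i. i \<in> J \<Longrightarrow> (\<lambda>x. g x i) \<in> borel_measurable M"
  shows "(\<lambda>x. \<lambda>i\<in>J. g x i) \<in> measurable M (lborel_fun J)"
  using assms by (intro measurable_restrict) simp

lemma product_sigma_finite_lborel: "product_sigma_finite (\<lambda>_ :: 'i. lborel :: real measure)"
  by unfold_locales

lemma sigma_finite_lborel_fun: "finite J \<Longrightarrow> sigma_finite_measure (lborel_fun J)"
  by (rule product_sigma_finite.sigma_finite[OF product_sigma_finite_lborel])

text \<open>The product measure is determined by boxes, and the preimage of a box under a
  translation is a box with shifted sides.\<close>

lemma distr_lborel_fun_translation:
  fixes c :: "'i \<Rightarrow> real"
  assumes J: "finite J"
  shows "distr (lborel_fun J) (lborel_fun J) (\<lambda>x. \<lambda>i\<in>J. x i + c i) = lborel_fun J"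
proof -
  have meas: "(\<lambda>x. \<lambda>i\<in>J. x i + c i) \<in> measurable (lborel_fun J) (lborel_fun J)"
    by (intro measurable_into_lborel_fun) measurable
  show ?thesis
  proof (rule product_sigma_finite.PiM_eqI[OF product_sigma_finite_lborel J])
    fix A :: "'i \<Rightarrow> real set" assume A: "\<And>i. i \<in> J \<Longrightarrow> A i \<in> sets lborel"
    let ?A' = "\<lambda>i. (\<lambda>r. r + c i) -` A i"
    have A': "?A' i \<in> sets lborel" if "i \<in> J" for i
      using measurable_sets[of "\<lambda>r. r + c i" borel borel "A i"] A[OF that] by simp
    have em: "emeasure lborel (?A' i) = emeasure lborel (A i)" if "i \<in> J" for i
    proof -
      have "emeasure (distr lborel borel ((+) (c i))) (A i) = emeasure lborel ((+) (c i) -` A i)"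
        using A[OF that] by (subst emeasure_distr) auto
      then show ?thesis by (simp add: lborel_distr_plus add.commute vimage_def)
    qed
    have "(\<lambda>x. \<lambda>i\<in>J. x i + c i) -` Pi\<^sub>E J A \<inter> space (lborel_fun J) = Pi\<^sub>E J ?A'"
      by (auto simp: space_PiM PiE_iff)
    moreover have "Pi\<^sub>E J A \<in> sets (lborel_fun J)"
      using A J by (intro sets_PiM_I_finite) auto
    ultimately have "emeasure (distr (lborel_fun J) (lborel_fun J) (\<lambda>x. \<lambda>i\<in>J. x i + c i)) (Pi\<^sub>E J A) =
        emeasure (lborel_fun J) (Pi\<^sub>E J ?A')"
      by (simp add: emeasure_distr[OF meas])
    also have "\<dots> = (\<Prod>i\<in>J. emeasure lborel (?A' i))"
      using A' by (intro product_sigma_finite.emeasure_PiM[OF product_sigma_finite_lborel J]) auto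
    also have "\<dots> = (\<Prod>i\<in>J. emeasure lborel (A i))"
      using em by (intro prod.cong) auto
    finally show "emeasure (distr (lborel_fun J) (lborel_fun J) (\<lambda>x. \<lambda>i\<in>J. x i + c i)) (Pi\<^sub>E J A) =
        (\<Prod>i\<in>J. emeasure lborel (A i))" .
  qed simp
qed

lemma emeasure_lborel_fun_translation:
  fixes c :: "'i \<Rightarrow> real"
  assumes J: "finite J" and F: "F \<in> sets (lborel_fun J)"
  shows "emeasure (lborel_fun J) {x \<in> J \<rightarrow>\<^sub>E UNIV. (\<lambda>i\<in>J. x i + c i) \<in> F} = emeasure (lborel_fun J) F"
proof -
  have meas: "(\<lambda>x. \<lambda>i\<in>J. x i + c i) \<in> measurable (lborel_fun J) (lborel_fun J)"
    by (intro measurable_into_lborel_fun) measurable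
  have "emeasure (lborel_fun J) F = emeasure (distr (lborel_fun J) (lborel_fun J) (\<lambda>x. \<lambda>i\<in>J. x i + c i)) F"
    by (simp add: distr_lborel_fun_translation J)
  also have "\<dots> = emeasure (lborel_fun J) {x \<in> J \<rightarrow>\<^sub>E UNIV. (\<lambda>i\<in>J. x i + c i) \<in> F}"
    unfolding emeasure_distr[OF meas F] space_lborel_fun
    by (intro arg_cong[where f = "emeasure _"]) auto
  finally show ?thesis by simp
qed

text \<open>Half-open, so that the integer translates cover space without overlap.\<close>

definition unit_cube :: "'i set \<Rightarrow> ('i \<Rightarrow> real) set" where
  "unit_cube J = J \<rightarrow>\<^sub>E {0..<1}"

lemma unit_cube_in_sets: "finite J \<Longrightarrow> unit_cube J \<in> sets (lborel_fun J)"
  unfolding unit_cube_def by (intro sets_PiM_I_finite) auto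

lemma emeasure_unit_cube: "finite J \<Longrightarrow> emeasure (lborel_fun J) (unit_cube J) = 1"
  unfolding unit_cube_def
  by (subst product_sigma_finite.emeasure_PiM[OF product_sigma_finite_lborel]) auto

text \<open>Cut \<open>F\<close> along the integer translates of the unit cube and shift every piece
  back into the cube. By \<open>ex\<close> the shifted pieces cover the cube, by
  \<open>unique\<close> they are disjoint.\<close>

lemma emeasure_fundamental_domain:
  assumes J: "finite J" and F: "F \<in> sets (lborel_fun J)"
    and ex: "\<And>x. x \<in> J \<rightarrow>\<^sub>E UNIV \<Longrightarrow> \<exists>z\<in>J \<rightarrow>\<^sub>E (UNIV :: int set). (\<lambda>i\<in>J. x i + of_int (z i)) \<in> F"
    and unique: "\<And>x z z'. x \<in> J \<rightarrow>\<^sub>E UNIV \<Longrightarrow> z \<in> J \<rightarrow>\<^sub>E (UNIV :: int set) \<Longrightarrow> z' \<in> J \<rightarrow>\<^sub>E UNIV \<Longrightarrow>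
      (\<lambda>i\<in>J. x i + of_int (z i)) \<in> F \<Longrightarrow> (\<lambda>i\<in>J. x i + of_int (z' i)) \<in> F \<Longrightarrow> z = z'"
  shows "emeasure (lborel_fun J) F = 1"
proof -
  define Z where "Z = J \<rightarrow>\<^sub>E (UNIV :: int set)"
  define K where "K z = (\<Pi>\<^sub>E i\<in>J. {real_of_int (z i)..<real_of_int (z i) + 1})" for z
  define sh where "sh z x = (\<lambda>i\<in>J. x i + real_of_int (z i))" for z x
  have countable: "countable Z" unfolding Z_def by (intro countable_PiE J) auto
  have K_sets: "K z \<in> sets (lborel_fun J)" for z
    unfolding K_def using J by (intro sets_PiM_I_finite) auto
  have disj_K: "disjoint_family_on (\<lambda>z. F \<inter> K z) Z"
    unfolding disjoint_family_on_def
  proof (intro ballI impI)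
    fix z z' assume z: "z \<in> Z" "z' \<in> Z" "z \<noteq> z'"
    have False if "x \<in> K z" "x \<in> K z'" for x
    proof -
      have "z i = z' i" if "i \<in> J" for i
      proof -
        have "\<lfloor>x i\<rfloor> = z i" "\<lfloor>x i\<rfloor> = z' i"
          using \<open>x \<in> K z\<close> \<open>x \<in> K z'\<close> that
          unfolding floor_eq_iff K_def by (auto simp only: PiE_iff atLeastLessThan_iff)
        then show ?thesis by (rule trans[OF sym])
      qed
      then have "z = z'" by (rule PiE_ext[OF z(1,2)[unfolded Z_def]])
      with z show False by simp
    qed
    then show "(F \<inter> K z) \<inter> (F \<inter> K z') = {}" by auto
  qed
  have sh_sets: "{x \<in> J \<rightarrow>\<^sub>E UNIV. sh z x \<in> F} \<in> sets (lborel_fun J)" for z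
  proof -
    have "sh z \<in> measurable (lborel_fun J) (lborel_fun J)"
      unfolding sh_def by (intro measurable_into_lborel_fun) measurable
    from measurable_sets[OF this F] show ?thesis
      by (simp add: space_lborel_fun vimage_def Int_def conj_commute)
  qed
  have "F = (\<Union>z\<in>Z. F \<inter> K z)"
  proof -
    have "x \<in> (\<Union>z\<in>Z. F \<inter> K z)" if "x \<in> F" for x
    proof (rule UN_I[of "\<lambda>i\<in>J. \<lfloor>x i\<rfloor>"])
      have "x \<in> J \<rightarrow>\<^sub>E UNIV" using sets.sets_into_space[OF F] that by (auto simp: space_lborel_fun)
      then show "x \<in> F \<inter> K (\<lambda>i\<in>J. \<lfloor>x i\<rfloor>)"
        using that by (auto simp: K_def PiE_iff)
    qed (simp add: Z_def)
    then show ?thesis by auto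
  qed
  then have "emeasure (lborel_fun J) F = emeasure (lborel_fun J) (\<Union>z\<in>Z. F \<inter> K z)"
    by (rule arg_cong)
  also have "\<dots> = (\<integral>\<^sup>+ z. emeasure (lborel_fun J) (F \<inter> K z) \<partial>count_space Z)"
    by (rule emeasure_UN_countable[OF _ countable disj_K]) (use F K_sets in auto)
  also have "\<dots> = (\<integral>\<^sup>+ z. emeasure (lborel_fun J) ({x \<in> J \<rightarrow>\<^sub>E UNIV. sh z x \<in> F} \<inter> unit_cube J) \<partial>count_space Z)"
  proof (intro nn_integral_cong)
    fix z
    have "sh z x \<in> K z \<longleftrightarrow> x \<in> unit_cube J" if "x \<in> J \<rightarrow>\<^sub>E UNIV" for x
      using that by (simp add: sh_def K_def unit_cube_def PiE_iff)
    moreover have "unit_cube J \<subseteq> J \<rightarrow>\<^sub>E UNIV" by (auto simp: unit_cube_def)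
    ultimately have "{x \<in> J \<rightarrow>\<^sub>E UNIV. sh z x \<in> F \<inter> K z} = {x \<in> J \<rightarrow>\<^sub>E UNIV. sh z x \<in> F} \<inter> unit_cube J"
      by blast
    then show "emeasure (lborel_fun J) (F \<inter> K z) =
        emeasure (lborel_fun J) ({x \<in> J \<rightarrow>\<^sub>E UNIV. sh z x \<in> F} \<inter> unit_cube J)"
      using emeasure_lborel_fun_translation[OF J sets.Int[OF F K_sets], of "\<lambda>i. real_of_int (z i)" z, folded sh_def]
      by (simp only:)
  qed
  also have "\<dots> = emeasure (lborel_fun J) (\<Union>z\<in>Z. {x \<in> J \<rightarrow>\<^sub>E UNIV. sh z x \<in> F} \<inter> unit_cube J)"
  proof (rule emeasure_UN_countable[symmetric, OF _ countable])
    show "disjoint_family_on (\<lambda>z. {x \<in> J \<rightarrow>\<^sub>E UNIV. sh z x \<in> F} \<inter> unit_cube J) Z"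
      unfolding disjoint_family_on_def
    proof (intro ballI impI)
      fix z z' assume z: "z \<in> Z" "z' \<in> Z" "z \<noteq> z'"
      have "\<not> (sh z x \<in> F \<and> sh z' x \<in> F)" if "x \<in> J \<rightarrow>\<^sub>E UNIV" for x
      proof
        assume "sh z x \<in> F \<and> sh z' x \<in> F"
        then have "sh z x \<in> F" "sh z' x \<in> F" by blast+
        then have "z = z'"
          unfolding sh_def by (rule unique[OF that z(1,2)[unfolded Z_def]])
        then show False using z(3) by contradiction
      qed
      then show "({x \<in> J \<rightarrow>\<^sub>E UNIV. sh z x \<in> F} \<inter> unit_cube J) \<inter>
          ({x \<in> J \<rightarrow>\<^sub>E UNIV. sh z' x \<in> F} \<inter> unit_cube J) = {}" by auto
    qed
  qed (use sh_sets unit_cube_in_sets[OF J] in auto)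
  also have "(\<Union>z\<in>Z. {x \<in> J \<rightarrow>\<^sub>E UNIV. sh z x \<in> F} \<inter> unit_cube J) = unit_cube J"
  proof -
    have "x \<in> (\<Union>z\<in>Z. {x \<in> J \<rightarrow>\<^sub>E UNIV. sh z x \<in> F})" if "x \<in> unit_cube J" for x
    proof -
      have x: "x \<in> J \<rightarrow>\<^sub>E UNIV" using that by (auto simp: unit_cube_def)
      from ex[OF this] obtain z where "z \<in> Z" "sh z x \<in> F" unfolding Z_def sh_def by (rule bexE)
      with x show ?thesis by (intro UN_I) simp_all
    qed
    then show ?thesis by auto
  qed
  finally show ?thesis by (simp add: emeasure_unit_cube J)
qed

text \<open>\<open>integral\<close>, \<open>onto\<close> and \<open>kernel\<close> together say that
  \<open>M\<close> maps the integer vectors on \<open>J\<close> bijectively to those on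
  \<open>N\<close>.\<close>

locale unimodular =
  fixes J :: "'i set" and N :: "'e set" and M :: "'i \<Rightarrow> 'e \<Rightarrow> real"
  assumes finite_J: "finite J" and finite_N: "finite N"
    and integral: "i \<in> J \<Longrightarrow> f \<in> N \<Longrightarrow> M i f \<in> \<int>"
    and onto: "g \<in> N \<Longrightarrow> \<exists>k :: 'i \<Rightarrow> int. \<forall>f\<in>N. (\<Sum>i\<in>J. of_int (k i) * M i f) = (if f = g then 1 else 0)"
    and kernel: "(\<And>f. f \<in> N \<Longrightarrow> (\<Sum>i\<in>J. x i * M i f) = 0) \<Longrightarrow> i \<in> J \<Longrightarrow> x i = 0"
begin

definition act :: "('e \<Rightarrow> real) \<Rightarrow> ('i \<Rightarrow> real) \<Rightarrow> 'e \<Rightarrow> real" where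
  "act y x = (\<lambda>f\<in>N. y f + (\<Sum>i\<in>J. x i * M i f))"

text \<open>The integer matrix \<open>k\<close> provides preimages of the unit vectors; combining
  its rows gives preimages of all integer and of all real vectors.\<close>

lemma ex_dual:
  "\<exists>k :: 'e \<Rightarrow> 'i \<Rightarrow> int. \<forall>g\<in>N. \<forall>f\<in>N. (\<Sum>i\<in>J. of_int (k g i) * M i f) = (if f = g then 1 else 0)"
  using onto by (intro bchoice) blast

lemma ex_int_preimage: "\<exists>k :: 'i \<Rightarrow> int. \<forall>f\<in>N. (\<Sum>i\<in>J. of_int (k i) * M i f) = of_int (w f)"
proof -
  obtain k :: "'e \<Rightarrow> 'i \<Rightarrow> int" where
    k: "\<forall>g\<in>N. \<forall>f\<in>N. (\<Sum>i\<in>J. of_int (k g i) * M i f) = (if f = g then 1 else 0)"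
    using ex_dual by blast
  have "(\<Sum>i\<in>J. of_int (\<Sum>g\<in>N. w g * k g i) * M i f) = of_int (w f)" if "f \<in> N" for f
  proof -
    have "(\<Sum>i\<in>J. of_int (\<Sum>g\<in>N. w g * k g i) * M i f) =
        (\<Sum>i\<in>J. \<Sum>g\<in>N. of_int (w g) * (of_int (k g i) * M i f))"
      by (simp add: sum_distrib_right mult.assoc)
    also have "\<dots> = (\<Sum>g\<in>N. of_int (w g) * (\<Sum>i\<in>J. of_int (k g i) * M i f))"
      by (subst sum.swap) (simp add: sum_distrib_left)
    also have "\<dots> = (\<Sum>g\<in>N. if g = f then of_int (w f) else 0)"
    proof (intro sum.cong refl)
      fix g assume "g \<in> N"
      then show "of_int (w g) * (\<Sum>i\<in>J. of_int (k g i) * M i f) = (if g = f then of_int (w f) else 0)"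
        using k that by simp
    qed
    finally show ?thesis using finite_N that by simp
  qed
  then show ?thesis by (intro exI[of _ "\<lambda>i. \<Sum>g\<in>N. w g * k g i"] ballI)
qed

lemma ex_preimage: "\<exists>u. \<forall>f\<in>N. (\<Sum>i\<in>J. u i * M i f) = w f"
proof -
  obtain k :: "'e \<Rightarrow> 'i \<Rightarrow> int" where
    k: "\<forall>g\<in>N. \<forall>f\<in>N. (\<Sum>i\<in>J. of_int (k g i) * M i f) = (if f = g then 1 else 0)"
    using ex_dual by blast
  have "(\<Sum>i\<in>J. (\<Sum>g\<in>N. w g * of_int (k g i)) * M i f) = w f" if "f \<in> N" for f
  proof -
    have "(\<Sum>i\<in>J. (\<Sum>g\<in>N. w g * of_int (k g i)) * M i f) =
        (\<Sum>i\<in>J. \<Sum>g\<in>N. w g * (of_int (k g i) * M i f))"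
      by (simp add: sum_distrib_right mult.assoc)
    also have "\<dots> = (\<Sum>g\<in>N. w g * (\<Sum>i\<in>J. of_int (k g i) * M i f))"
      by (subst sum.swap) (simp add: sum_distrib_left)
    also have "\<dots> = (\<Sum>g\<in>N. if g = f then w f else 0)"
    proof (intro sum.cong refl)
      fix g assume "g \<in> N"
      then show "w g * (\<Sum>i\<in>J. of_int (k g i) * M i f) = (if g = f then w f else 0)"
        using k that by simp
    qed
    finally show ?thesis using finite_N that by simp
  qed
  then show ?thesis by (intro exI[of _ "\<lambda>i. \<Sum>g\<in>N. w g * of_int (k g i)"] ballI)
qed

lemma measurable_act:
  "(\<lambda>p. act (snd p) (fst p)) \<in> measurable (lborel_fun J \<Otimes>\<^sub>M lborel_fun N) (lborel_fun N)"
  "(\<lambda>p. act (snd p) (\<lambda>i. - fst p i)) \<in> measurable (lborel_fun J \<Otimes>\<^sub>M lborel_fun N) (lborel_fun N)"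
  unfolding act_def by (intro measurable_into_lborel_fun; measurable)+

lemma measurable_act1:
  "act y \<in> measurable (lborel_fun J) (lborel_fun N)"
  "(\<lambda>x. act y (\<lambda>i. - x i)) \<in> measurable (lborel_fun J) (lborel_fun N)"
  unfolding act_def by (intro measurable_into_lborel_fun; measurable)+

lemma preimage_in_sets: "A \<in> sets (lborel_fun N) \<Longrightarrow> {x \<in> J \<rightarrow>\<^sub>E UNIV. act y x \<in> A} \<in> sets (lborel_fun J)"
  using measurable_sets[OF measurable_act1(1)[of y]]
  by (simp add: space_lborel_fun vimage_def Int_def conj_commute)

text \<open>\<open>M\<close> is onto over the reals, so a change of the base point is undone by a
  translation of \<open>x\<close>.\<close>

lemma emeasure_preimage_indep:
  assumes A: "A \<in> sets (lborel_fun N)"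
  shows "emeasure (lborel_fun J) {x \<in> J \<rightarrow>\<^sub>E UNIV. act p x \<in> A} =
    emeasure (lborel_fun J) {x \<in> J \<rightarrow>\<^sub>E UNIV. act y x \<in> A}"
proof -
  obtain u where u: "\<And>f. f \<in> N \<Longrightarrow> (\<Sum>i\<in>J. u i * M i f) = p f - y f"
    using ex_preimage[of "\<lambda>f. p f - y f"] by blast
  have "act y (\<lambda>i\<in>J. x i + u i) = act p x" for x
    unfolding act_def using u by (intro restrict_ext) (simp add: distrib_right sum.distrib)
  then show ?thesis
    using emeasure_lborel_fun_translation[OF finite_J preimage_in_sets[OF A, of y], of u] by simp
qed

text \<open>The set is a fundamental domain: shifting \<open>x\<close> by an integer vector
  \<open>z\<close> lands in it exactly if \<open>M\<close> maps \<open>z\<close> to the floors of y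
  - M x, and this has one integer solution.\<close>

lemma emeasure_cube_preimage:
  "emeasure (lborel_fun J) {x \<in> J \<rightarrow>\<^sub>E UNIV. act y (\<lambda>i. - x i) \<in> unit_cube N} = 1"
proof (rule emeasure_fundamental_domain[OF finite_J])
  show "{x \<in> J \<rightarrow>\<^sub>E UNIV. act y (\<lambda>i. - x i) \<in> unit_cube N} \<in> sets (lborel_fun J)"
    using measurable_sets[OF measurable_act1(2)[of y] unit_cube_in_sets[OF finite_N]]
    by (simp add: space_lborel_fun vimage_def Int_def conj_commute)
  fix x :: "'i \<Rightarrow> real"
  define w where "w f = y f - (\<Sum>i\<in>J. x i * M i f)" for f
  have iff: "act y (\<lambda>i. - (\<lambda>i\<in>J. x i + of_int (z i)) i) \<in> unit_cube N \<longleftrightarrow>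
      (\<forall>f\<in>N. (\<Sum>i\<in>J. of_int (z i) * M i f) = of_int \<lfloor>w f\<rfloor>)" for z :: "'i \<Rightarrow> int"
  proof -
    have "0 \<le> w f - (\<Sum>i\<in>J. of_int (z i) * M i f) \<and> w f - (\<Sum>i\<in>J. of_int (z i) * M i f) < 1 \<longleftrightarrow>
        (\<Sum>i\<in>J. of_int (z i) * M i f) = of_int \<lfloor>w f\<rfloor>" if "f \<in> N" for f
    proof -
      have "(\<Sum>i\<in>J. of_int (z i) * M i f) \<in> \<int>"
        using that integral by (intro Ints_sum Ints_mult) auto
      then obtain m where m: "(\<Sum>i\<in>J. of_int (z i) * M i f) = of_int m" by (rule Ints_cases)
      have "0 \<le> w f - of_int m \<and> w f - of_int m < 1 \<longleftrightarrow> \<lfloor>w f\<rfloor> = m"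
        unfolding floor_eq_iff by (auto simp: algebra_simps)
      then show ?thesis unfolding m of_int_eq_iff by blast
    qed
    moreover have "y f + (\<Sum>i\<in>J. - (\<lambda>i\<in>J. x i + of_int (z i)) i * M i f) =
        w f - (\<Sum>i\<in>J. of_int (z i) * M i f)" for f
      by (simp add: w_def distrib_right sum.distrib sum_negf left_diff_distrib sum_subtractf)
    ultimately show ?thesis
      unfolding act_def unit_cube_def by (simp add: PiE_iff)
  qed
  obtain k :: "'i \<Rightarrow> int" where k: "\<forall>f\<in>N. (\<Sum>i\<in>J. of_int (k i) * M i f) = of_int \<lfloor>w f\<rfloor>"
    using ex_int_preimage[of "\<lambda>f. \<lfloor>w f\<rfloor>"] by blast
  have "\<forall>f\<in>N. (\<Sum>i\<in>J. of_int (restrict k J i) * M i f) = of_int \<lfloor>w f\<rfloor>" using k by simp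
  then show "\<exists>z\<in>J \<rightarrow>\<^sub>E (UNIV :: int set).
      (\<lambda>i\<in>J. x i + of_int (z i)) \<in> {x \<in> J \<rightarrow>\<^sub>E UNIV. act y (\<lambda>i. - x i) \<in> unit_cube N}"
    by (intro bexI[of _ "restrict k J"]) (simp_all only: mem_Collect_eq iff, auto)
  fix z z' :: "'i \<Rightarrow> int" assume zJ: "z \<in> J \<rightarrow>\<^sub>E UNIV" "z' \<in> J \<rightarrow>\<^sub>E UNIV"
  assume "(\<lambda>i\<in>J. x i + of_int (z i)) \<in> {x \<in> J \<rightarrow>\<^sub>E UNIV. act y (\<lambda>i. - x i) \<in> unit_cube N}"
    "(\<lambda>i\<in>J. x i + of_int (z' i)) \<in> {x \<in> J \<rightarrow>\<^sub>E UNIV. act y (\<lambda>i. - x i) \<in> unit_cube N}"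
  then have z: "\<forall>f\<in>N. (\<Sum>i\<in>J. of_int (z i) * M i f) = of_int \<lfloor>w f\<rfloor>"
    "\<forall>f\<in>N. (\<Sum>i\<in>J. of_int (z' i) * M i f) = of_int \<lfloor>w f\<rfloor>"
    unfolding mem_Collect_eq iff by blast+
  have "of_int (z i) - of_int (z' i) = (0 :: real)" if "i \<in> J" for i
    using kernel[of "\<lambda>i. of_int (z i) - of_int (z' i)" i] z that
    by (simp add: left_diff_distrib sum_subtractf)
  then show "z = z'" by (intro PiE_ext[OF zJ]) simp
qed

text \<open>Averaging over \<open>y\<close> in the unit cube, the measure of \<open>{x. y + M x \<in> A}\<close>, which does not depend
  on \<open>y\<close>, becomes after a translation the integral over \<open>y \<in> A\<close> of the measure of
  \<open>{x. y - M x \<in> unit_cube N}\<close>. The latter set is a fundamental domain of the integer lattice.\<close>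

lemma emeasure_affine_preimage:
  assumes A: "A \<in> sets (lborel_fun N)"
  shows "emeasure (lborel_fun J) {x \<in> J \<rightarrow>\<^sub>E UNIV. act p x \<in> A} = emeasure (lborel_fun N) A"
proof -
  let ?X = "lborel_fun J" and ?Y = "lborel_fun N"
  let ?Q = "unit_cube N"
  interpret X: sigma_finite_measure ?X by (rule sigma_finite_lborel_fun[OF finite_J])
  interpret Y: sigma_finite_measure ?Y by (rule sigma_finite_lborel_fun[OF finite_N])
  interpret XY: pair_sigma_finite ?X ?Y by unfold_locales
  note indA = borel_measurable_indicator[OF A]
  note indQ = borel_measurable_indicator[OF unit_cube_in_sets[OF finite_N]]
  define T where "T = emeasure ?X {x \<in> J \<rightarrow>\<^sub>E UNIV. act p x \<in> A}"
  have T: "(\<integral>\<^sup>+ x. indicator A (act y x) \<partial>?X) = T" for y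
  proof -
    have "(\<integral>\<^sup>+ x. indicator A (act y x) \<partial>?X) =
        (\<integral>\<^sup>+ x. indicator {x \<in> J \<rightarrow>\<^sub>E UNIV. act y x \<in> A} x \<partial>?X)"
      by (intro nn_integral_cong) (simp add: space_lborel_fun indicator_def)
    also have "\<dots> = emeasure ?X {x \<in> J \<rightarrow>\<^sub>E UNIV. act y x \<in> A}"
      by (rule nn_integral_indicator[OF preimage_in_sets[OF A]])
    finally show ?thesis unfolding T_def using emeasure_preimage_indep[OF A] by simp
  qed
  have Q: "(\<integral>\<^sup>+ x. indicator ?Q (act y (\<lambda>i. - x i)) \<partial>?X) = 1" for y
  proof -
    have "{x \<in> J \<rightarrow>\<^sub>E UNIV. act y (\<lambda>i. - x i) \<in> ?Q} \<in> sets ?X"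
      using measurable_sets[OF measurable_act1(2)[of y] unit_cube_in_sets[OF finite_N]]
      by (simp add: space_lborel_fun vimage_def Int_def conj_commute)
    then have "(\<integral>\<^sup>+ x. indicator {x \<in> J \<rightarrow>\<^sub>E UNIV. act y (\<lambda>i. - x i) \<in> ?Q} x \<partial>?X) = 1"
      by (simp add: emeasure_cube_preimage)
    moreover have "(\<integral>\<^sup>+ x. indicator ?Q (act y (\<lambda>i. - x i)) \<partial>?X) =
        (\<integral>\<^sup>+ x. indicator {x \<in> J \<rightarrow>\<^sub>E UNIV. act y (\<lambda>i. - x i) \<in> ?Q} x \<partial>?X)"
      by (intro nn_integral_cong) (simp add: space_lborel_fun indicator_def)
    ultimately show ?thesis by simp
  qed
  have shift: "(\<integral>\<^sup>+ y. indicator ?Q y * indicator A (act y x) \<partial>?Y) =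
      (\<integral>\<^sup>+ y. indicator ?Q (act y (\<lambda>i. - x i)) * indicator A y \<partial>?Y)" if x: "x \<in> space ?X" for x
  proof -
    have inv: "act (act y (\<lambda>i. - x i)) x = y" if "y \<in> N \<rightarrow>\<^sub>E UNIV" for y
      using that by (auto simp: act_def sum_negf fun_eq_iff PiE_iff extensional_def)
    have m: "(\<lambda>y. act y x) \<in> measurable ?Y ?Y" "(\<lambda>y. act y (\<lambda>i. - x i)) \<in> measurable ?Y ?Y"
      unfolding act_def by (intro measurable_into_lborel_fun; measurable)+
    \<comment> \<open>For fixed \<open>x\<close>, subtracting M x is a translation of
      \<open>y\<close>; adding it back is the inverse recorded in \<open>inv\<close>.\<close>
    have "?Y = distr ?Y ?Y (\<lambda>y. act y (\<lambda>i. - x i))"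
      unfolding act_def by (rule distr_lborel_fun_translation[OF finite_N, symmetric])
    then have "(\<integral>\<^sup>+ y. indicator ?Q y * indicator A (act y x) \<partial>?Y) =
        (\<integral>\<^sup>+ y. indicator ?Q y * indicator A (act y x) \<partial>distr ?Y ?Y (\<lambda>y. act y (\<lambda>i. - x i)))" by simp
    also have "\<dots> = (\<integral>\<^sup>+ y. indicator ?Q (act y (\<lambda>i. - x i)) *
        indicator A (act (act y (\<lambda>i. - x i)) x) \<partial>?Y)"
      by (rule nn_integral_distr[OF m(2)], unfold measurable_distr_eq1)
        (intro borel_measurable_times_ennreal indQ measurable_compose[OF m(1) indA])
    also have "\<dots> = (\<integral>\<^sup>+ y. indicator ?Q (act y (\<lambda>i. - x i)) * indicator A y \<partial>?Y)"
      by (intro nn_integral_cong) (simp add: inv space_lborel_fun)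
    finally show ?thesis .
  qed
  \<comment> \<open>The cube has measure 1, so averaging over it does not change the constant
    \<open>T\<close>.\<close>
  have "T = (\<integral>\<^sup>+ y. indicator ?Q y * T \<partial>?Y)"
    using emeasure_unit_cube[OF finite_N] unit_cube_in_sets[OF finite_N] by (simp add: nn_integral_multc)
  also have "\<dots> = (\<integral>\<^sup>+ y. \<integral>\<^sup>+ x. indicator ?Q y * indicator A (act y x) \<partial>?X \<partial>?Y)"
    by (simp add: nn_integral_cmult measurable_compose[OF measurable_act1(1) indA] T)
  also have "\<dots> = (\<integral>\<^sup>+ x. \<integral>\<^sup>+ y. indicator ?Q y * indicator A (act y x) \<partial>?Y \<partial>?X)"
    by (rule XY.Fubini', unfold case_prod_unfold)
      (intro borel_measurable_times_ennreal measurable_compose[OF measurable_snd indQ]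
        measurable_compose[OF measurable_act(1) indA])
  also have "\<dots> = (\<integral>\<^sup>+ x. \<integral>\<^sup>+ y. indicator ?Q (act y (\<lambda>i. - x i)) * indicator A y \<partial>?Y \<partial>?X)"
    by (intro nn_integral_cong shift)
  also have "\<dots> = (\<integral>\<^sup>+ y. \<integral>\<^sup>+ x. indicator ?Q (act y (\<lambda>i. - x i)) * indicator A y \<partial>?X \<partial>?Y)"
    by (rule XY.Fubini'[symmetric], unfold case_prod_unfold)
      (intro borel_measurable_times_ennreal measurable_compose[OF measurable_snd indA]
        measurable_compose[OF measurable_act(2) indQ])
  also have "\<dots> = (\<integral>\<^sup>+ y. indicator A y \<partial>?Y)"
    by (simp add: nn_integral_multc measurable_compose[OF measurable_act1(2) indQ] Q)
  also have "\<dots> = emeasure ?Y A" using A by simp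
  finally show ?thesis unfolding T_def .
qed

end

section \<open>Labelings of a path\<close>

text \<open>A labeling is treated as the word of its values, cut into blocks of lengths
  \<open>ks\<close>, so that the first block can be split off. Blocks may be empty.\<close>

fun blockwise_increasing :: "nat list \<Rightarrow> nat list \<Rightarrow> bool" where
  "blockwise_increasing [] xs \<longleftrightarrow> xs = []"
| "blockwise_increasing (k # ks) xs \<longleftrightarrow>
     k \<le> length xs \<and> sorted_wrt (<) (take k xs) \<and> blockwise_increasing ks (drop k xs)"

text \<open>An increasing block is determined by its set of entries. Choose that set
  \<open>S\<close> for the first block and fill the rest from \<open>L - S\<close>, whence the
  general label set; the binomial coefficients multiply to the multinomial one.\<close>

lemma card_blockwise_increasing:
  "finite L \<Longrightarrow> card L = sum_list ks \<Longrightarrow>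
     finite {xs. distinct xs \<and> set xs = L \<and> blockwise_increasing ks xs} \<and>
     card {xs. distinct xs \<and> set xs = L \<and> blockwise_increasing ks xs} * prod_list (map fact ks) = fact (card L)"
proof (induction ks arbitrary: L)
  case Nil
  then have "{xs. distinct xs \<and> set xs = L \<and> blockwise_increasing [] xs} = {[]}" by auto
  then show ?case using Nil by (simp only: card.empty sum_list.Nil prod_list.Nil list.map fact_0) simp
next
  case (Cons k ks)
  let ?X = "\<lambda>ks L. {xs. distinct xs \<and> set xs = L \<and> blockwise_increasing ks xs}"
  let ?S = "{S. S \<subseteq> L \<and> card S = k}"
  let ?f = "\<lambda>(S, ys). sorted_list_of_set S @ ys"
  have fin: "finite S" if "S \<in> ?S" for S using that Cons.prems(1) finite_subset by blast
  have card_diff: "card (L - S) = sum_list ks" if "S \<in> ?S" for S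
    using that Cons.prems fin[OF that] by (simp add: card_Diff_subset)
  have IH: "finite (?X ks (L - S))" "card (?X ks (L - S)) * prod_list (map fact ks) = fact (sum_list ks)"
    if "S \<in> ?S" for S
    using Cons.IH[of "L - S"] card_diff[OF that] Cons.prems(1) by auto
  have "?X (k # ks) L = ?f ` Sigma ?S (\<lambda>S. ?X ks (L - S))"
  proof (intro equalityI subsetI)
    fix xs assume xs: "xs \<in> ?X (k # ks) L"
    then have d: "distinct (take k xs)" "distinct (drop k xs)" "set (take k xs) \<inter> set (drop k xs) = {}"
      using distinct_append[of "take k xs" "drop k xs"] by simp_all
    have u: "set (take k xs) \<union> set (drop k xs) = L" using xs set_append[of "take k xs" "drop k xs"] by simp
    have "sorted_list_of_set (set (take k xs)) = take k xs"
      using xs d(1) by (intro sorted_list_of_set.idem_if_sorted_distinct) (auto simp: strict_sorted_iff)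
    moreover have "card (set (take k xs)) = k" using xs d(1) by (simp add: distinct_card)
    moreover have "drop k xs \<in> ?X ks (L - set (take k xs))" using xs d u by auto
    moreover have "set (take k xs) \<subseteq> L" using u by blast
    ultimately show "xs \<in> ?f ` Sigma ?S (\<lambda>S. ?X ks (L - S))"
      by (intro image_eqI[of _ _ "(set (take k xs), drop k xs)"]) simp_all
  next
    fix xs assume "xs \<in> ?f ` Sigma ?S (\<lambda>S. ?X ks (L - S))"
    then obtain S ys where S: "S \<in> ?S" and ys: "ys \<in> ?X ks (L - S)" and xs: "xs = sorted_list_of_set S @ ys"
      by auto
    have "length (sorted_list_of_set S) = k" using S by simp
    then show "xs \<in> ?X (k # ks) L"
      using S ys fin[OF S] by (auto simp: xs)
  qed
  moreover have "inj_on ?f (Sigma ?S (\<lambda>S. ?X ks (L - S)))"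
  proof (rule inj_onI, clarify)
    fix S ys S' ys' assume "S \<subseteq> L" "S' \<subseteq> L" "card S' = card S" "sorted_list_of_set S @ ys = sorted_list_of_set S' @ ys'"
    moreover from this have "finite S" "finite S'" using Cons.prems(1) finite_subset by blast+
    ultimately show "S = S' \<and> ys = ys'"
      by (metis append_eq_append_conv length_sorted_list_of_set sorted_list_of_set.set_sorted_key_list_of_set)
  qed
  moreover have finS: "finite ?S" using Cons.prems(1) by simp
  moreover have "finite (Sigma ?S (\<lambda>S. ?X ks (L - S)))" using finS IH(1) by (rule finite_SigmaI)
  moreover have "card (Sigma ?S (\<lambda>S. ?X ks (L - S))) = (\<Sum>S\<in>?S. card (?X ks (L - S)))"
    using finS IH(1) by (intro card_SigmaI) blast+
  ultimately have fin_card: "finite (?X (k # ks) L)"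
    "card (?X (k # ks) L) = (\<Sum>S\<in>?S. card (?X ks (L - S)))"
    by (simp_all only: card_image finite_imageI)
  have "card (?X (k # ks) L) * prod_list (map fact (k # ks)) =
      (\<Sum>S\<in>?S. card (?X ks (L - S)) * prod_list (map fact ks)) * fact k"
    unfolding fin_card(2) sum_distrib_right[symmetric] by simp
  also have "\<dots> = (\<Sum>S\<in>?S. fact (sum_list ks)) * fact k" using IH(2) by simp
  also have "\<dots> = (card L choose k) * fact (sum_list ks) * fact k"
    using n_subsets[OF Cons.prems(1), of k] by simp
  also have "\<dots> = fact (card L)"
    using binomial_fact_lemma[of k "card L"] Cons.prems(2) by (simp add: mult_ac)
  finally show ?case using fin_card(1) by blast
qed

text \<open>Entries are distinct, so increasing inside the blocks means that descents occur only at
  block boundaries. Position \<open>p\<close> counts the entries before the descent, which compares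
  the indices \<open>p - 1\<close> and \<open>p\<close>.\<close>

lemma blockwise_increasing_iff:
  assumes "distinct xs" and "length xs = sum_list ks"
  shows "blockwise_increasing ks xs \<longleftrightarrow>
    (\<forall>p. 0 < p \<and> p < length xs \<and> xs ! (p - 1) > xs ! p \<longrightarrow> (\<exists>i\<le>length ks. p = sum_list (take i ks)))"
  using assms
proof (induction ks arbitrary: xs)
  case Nil
  then show ?case by simp
next
  case (Cons k ks)
  let ?cut = "\<lambda>ks p. \<exists>i\<le>length ks. p = sum_list (take i ks)"
  have k: "k \<le> length xs" using Cons.prems by simp
  have IH: "blockwise_increasing ks (drop k xs) \<longleftrightarrow>
      (\<forall>p. 0 < p \<and> p < length xs - k \<and> xs ! (k + (p - 1)) > xs ! (k + p) \<longrightarrow> ?cut ks p)"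
    using Cons.IH[of "drop k xs"] Cons.prems by (auto simp: distinct_drop)
  \<comment> \<open>The boundaries of \<open>k # ks\<close> are 0 and those of \<open>ks\<close>
    shifted by \<open>k\<close>.\<close>
  have cut0: "?cut (k # ks) p \<longleftrightarrow> p = 0 \<or> (k \<le> p \<and> ?cut ks (p - k))" for p
  proof
    assume "?cut (k # ks) p"
    then obtain i where i: "i \<le> Suc (length ks)" "p = sum_list (take i (k # ks))" by auto
    show "p = 0 \<or> (k \<le> p \<and> ?cut ks (p - k))"
      using i by (cases i) auto
  next
    assume "p = 0 \<or> (k \<le> p \<and> ?cut ks (p - k))"
    then show "?cut (k # ks) p"
    proof
      assume "k \<le> p \<and> ?cut ks (p - k)"
      then obtain i where "i \<le> length ks" "p = k + sum_list (take i ks)" by auto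
      then show ?thesis by (intro exI[of _ "Suc i"]) simp
    qed (auto intro: exI[of _ 0])
  qed
  have sorted: "sorted_wrt (<) (take k xs) \<longleftrightarrow> (\<forall>p. 0 < p \<and> p < k \<longrightarrow> xs ! (p - 1) < xs ! p)"
  proof -
    have "sorted_wrt (<) (take k xs) \<longleftrightarrow> (\<forall>i. Suc i < k \<longrightarrow> xs ! i < xs ! Suc i)"
      using k by (subst sorted_wrt_iff_nth_Suc_transp) auto
    also have "\<dots> \<longleftrightarrow> (\<forall>p. 0 < p \<and> p < k \<longrightarrow> xs ! (p - 1) < xs ! p)"
    proof (intro iffI allI impI)
      fix p assume "\<forall>i. Suc i < k \<longrightarrow> xs ! i < xs ! Suc i" and p: "0 < p \<and> p < k"
      then show "xs ! (p - 1) < xs ! p" by (cases p) simp_all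
    next
      fix i assume "\<forall>p. 0 < p \<and> p < k \<longrightarrow> xs ! (p - 1) < xs ! p" and "Suc i < k"
      then show "xs ! i < xs ! Suc i" by (auto dest: spec[of _ "Suc i"])
    qed
    finally show ?thesis .
  qed
  have neq: "xs ! (p - 1) < xs ! p \<longleftrightarrow> \<not> xs ! (p - 1) > xs ! p" if "0 < p" "p < length xs" for p
  proof -
    have "xs ! (p - 1) \<noteq> xs ! p"
      using that Cons.prems(1) nth_eq_iff_index_eq[of xs "p - 1" p] by simp
    then show ?thesis by linarith
  qed
  show ?case
  proof
    assume B: "blockwise_increasing (k # ks) xs"
    show "\<forall>p. 0 < p \<and> p < length xs \<and> xs ! (p - 1) > xs ! p \<longrightarrow> ?cut (k # ks) p"
    proof (intro allI impI)
      fix p assume p: "0 < p \<and> p < length xs \<and> xs ! (p - 1) > xs ! p"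
      have "k \<le> p"
      proof (rule ccontr)
        assume "\<not> k \<le> p"
        then have "xs ! (p - 1) < xs ! p" using B p sorted by simp
        then show False using p by simp
      qed
      moreover have "?cut ks (p - k)"
      proof (cases "p = k")
        case False
        then have "k + (p - k - 1) = p - 1" "k + (p - k) = p" "0 < p - k" "p - k < length xs - k"
          using \<open>k \<le> p\<close> p by auto
        moreover have "blockwise_increasing ks (drop k xs)" using B by simp
        ultimately show ?thesis using p IH[THEN iffD1, rule_format, of "p - k"] by simp
      qed (auto intro: exI[of _ 0])
      ultimately show "?cut (k # ks) p" unfolding cut0 by blast
    qed
  next
    assume R: "\<forall>p. 0 < p \<and> p < length xs \<and> xs ! (p - 1) > xs ! p \<longrightarrow> ?cut (k # ks) p"
    have "xs ! (p - 1) < xs ! p" if "0 < p" "p < k" for p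
    proof (rule ccontr)
      assume "\<not> xs ! (p - 1) < xs ! p"
      then have "?cut (k # ks) p" using R neq[of p] that k by auto
      then show False using that unfolding cut0 by auto
    qed
    moreover have "?cut ks p" if "0 < p" "p < length xs - k" "xs ! (k + (p - 1)) > xs ! (k + p)" for p
    proof -
      have "k + p - 1 = k + (p - 1)" using that by simp
      then have "?cut (k # ks) (k + p)" using R[rule_format, of "k + p"] that by auto
      then show ?thesis unfolding cut0 using that by auto
    qed
    ultimately show "blockwise_increasing (k # ks) xs"
      using k IH sorted by auto
  qed
qed

lemma card_permutations_with_descents:
  fixes s :: "nat \<Rightarrow> nat" and n :: nat
  defines "d \<equiv> \<Sum>j=1..n. s j"
  shows "card {\<sigma>. \<sigma> permutes {1..d} \<and> (\<forall>p. 1 \<le> p \<and> p < d \<and> \<sigma> p > \<sigma> (p + 1) \<longrightarrow>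
           (\<exists>i\<in>{1..n}. p = (\<Sum>j=1..i. s j)))} * (\<Prod>i=1..n. fact (s i)) = fact d"
proof -
  define ks where "ks = map s [1..<Suc n]"
  define P where "P = {\<sigma>. \<sigma> permutes {1..d} \<and> (\<forall>p. 1 \<le> p \<and> p < d \<and> \<sigma> p > \<sigma> (p + 1) \<longrightarrow>
           (\<exists>i\<in>{1..n}. p = (\<Sum>j=1..i. s j)))}"
  define X where "X = {xs. distinct xs \<and> set xs = {1..d} \<and> blockwise_increasing ks xs}"
  define h where "h \<sigma> = map \<sigma> [1..<Suc d]" for \<sigma> :: "nat \<Rightarrow> nat"
  have take: "sum_list (take i ks) = (\<Sum>j=1..i. s j)" if "i \<le> n" for i
    using that unfolding ks_def
    by (simp add: take_map interv_sum_list_conv_sum_set_nat take_upt atLeastLessThanSuc_atLeastAtMost del: upt_Suc)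
  have sum_ks: "sum_list ks = d"
    using take[of n] by (simp add: ks_def d_def)
  have blockwise: "blockwise_increasing ks (h \<sigma>) \<longleftrightarrow> (\<forall>p. 1 \<le> p \<and> p < d \<and> \<sigma> p > \<sigma> (p + 1) \<longrightarrow>
           (\<exists>i\<in>{1..n}. p = (\<Sum>j=1..i. s j)))" if "distinct (h \<sigma>)" for \<sigma>
  proof -
    \<comment> \<open>The boundary with \<open>i = 0\<close> is missing on the right; it would be
      \<open>p = 0\<close>, which is excluded.\<close>
    have cut: "(\<exists>i\<le>length ks. p = sum_list (take i ks)) \<longleftrightarrow> (\<exists>i\<in>{1..n}. p = (\<Sum>j=1..i. s j))" if "0 < p" for p
    proof -
      have "(\<exists>i\<le>length ks. p = sum_list (take i ks)) \<longleftrightarrow> (\<exists>i\<le>n. p = (\<Sum>j=1..i. s j))"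
        using take by (auto simp: ks_def)
      also have "\<dots> \<longleftrightarrow> (\<exists>i\<in>{1..n}. p = (\<Sum>j=1..i. s j))"
      proof
        assume "\<exists>i\<le>n. p = (\<Sum>j=1..i. s j)"
        then obtain i where i: "i \<le> n" "p = (\<Sum>j=1..i. s j)" by blast
        then have "i \<noteq> 0" using that by (intro notI) simp
        then show "\<exists>i\<in>{1..n}. p = (\<Sum>j=1..i. s j)" using i by (intro bexI[of _ i]) auto
      qed auto
      finally show ?thesis .
    qed
    have nth: "h \<sigma> ! (p - 1) = \<sigma> p" "h \<sigma> ! p = \<sigma> (p + 1)" if "0 < p" "p < d" for p
      using that by (simp_all add: h_def del: upt_Suc)
    have len: "length (h \<sigma>) = d" by (simp add: h_def)
    have "blockwise_increasing ks (h \<sigma>) \<longleftrightarrow> (\<forall>p. 0 < p \<and> p < d \<and> h \<sigma> ! (p - 1) > h \<sigma> ! p \<longrightarrow>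
        (\<exists>i\<le>length ks. p = sum_list (take i ks)))"
      using blockwise_increasing_iff[OF that, of ks] by (simp add: len sum_ks)
    also have "\<dots> \<longleftrightarrow> (\<forall>p. 1 \<le> p \<and> p < d \<and> \<sigma> p > \<sigma> (p + 1) \<longrightarrow> (\<exists>i\<in>{1..n}. p = (\<Sum>j=1..i. s j)))"
      (is "(\<forall>p. ?l p) \<longleftrightarrow> (\<forall>p. ?r p)")
    proof (rule iff_allI)
      fix p show "?l p \<longleftrightarrow> ?r p"
      proof (cases "0 < p \<and> p < d")
        case True
        then show ?thesis unfolding cut[OF conjunct1[OF True]] using nth[of p] by simp
      qed auto
    qed
    finally show ?thesis .
  qed
  have "bij_betw h P X"
  proof (rule bij_betw_imageI)
    show "inj_on h P"
    proof (rule inj_onI)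
      fix \<sigma> \<sigma>' assume "\<sigma> \<in> P" "\<sigma>' \<in> P" and h: "h \<sigma> = h \<sigma>'"
      then have p: "\<sigma> permutes {1..d}" "\<sigma>' permutes {1..d}" by (auto simp: P_def)
      show "\<sigma> = \<sigma>'"
      proof
        fix x
        show "\<sigma> x = \<sigma>' x"
        proof (cases "x \<in> {1..d}")
          case True
          then have "x \<in> set [1..<Suc d]" by (simp del: upt_Suc)
          then show ?thesis using h unfolding h_def map_eq_conv by blast
        next
          case False
          then show ?thesis using permutes_not_in[OF p(1)] permutes_not_in[OF p(2)] by simp
        qed
      qed
    qed
    show "h ` P = X"
    proof (intro equalityI subsetI)
      fix xs assume "xs \<in> h ` P"
      then obtain \<sigma> where \<sigma>: "\<sigma> \<in> P" "xs = h \<sigma>" by blast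
      then have p: "\<sigma> permutes {1..d}" by (simp add: P_def)
      have "distinct (h \<sigma>)"
        unfolding h_def distinct_map using permutes_inj_on[OF p] by simp
      moreover have "set (h \<sigma>) = {1..d}"
        using permutes_image[OF p] by (simp add: h_def atLeastLessThanSuc_atLeastAtMost del: upt_Suc)
      ultimately show "xs \<in> X" using \<sigma> blockwise unfolding X_def P_def by blast
    next
      fix xs assume xs: "xs \<in> X"
      then have len: "length xs = d" using distinct_card[of xs] by (simp add: X_def)
      \<comment> \<open>Words are indexed from 0, north steps from 1; outside the interval
        \<open>permutes\<close> demands the identity.\<close>
      define \<sigma> where "\<sigma> p = (if p \<in> {1..d} then xs ! (p - 1) else p)" for p
      have h: "h \<sigma> = xs"
        by (rule nth_equalityI) (auto simp: h_def len \<sigma>_def simp del: upt_Suc)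
      have "bij_betw \<sigma> {1..d} {1..d}"
      proof (rule bij_betw_imageI)
        show "inj_on \<sigma> {1..d}"
        proof (rule inj_onI)
          fix p q assume "p \<in> {1..d}" "q \<in> {1..d}" "\<sigma> p = \<sigma> q"
          then have "p - 1 = q - 1"
            using xs len nth_eq_iff_index_eq[of xs "p - 1" "q - 1"] by (auto simp: \<sigma>_def X_def)
          then show "p = q" using \<open>p \<in> {1..d}\<close> \<open>q \<in> {1..d}\<close> by auto
        qed
        have "\<sigma> ` {1..d} = set (h \<sigma>)"
          by (simp add: h_def atLeastLessThanSuc_atLeastAtMost del: upt_Suc)
        then show "\<sigma> ` {1..d} = {1..d}" using xs unfolding h X_def by simp
      qed
      then have "\<sigma> permutes {1..d}"
        by (rule bij_imp_permutes) (auto simp: \<sigma>_def)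
      then have "\<sigma> \<in> P" using blockwise[of \<sigma>] xs unfolding h P_def X_def by blast
      then show "xs \<in> h ` P" using h by blast
    qed
  qed
  then have "card P = card X" by (rule bij_betw_same_card)
  moreover have "prod_list (map fact ks) = (\<Prod>i=1..n. fact (s i) :: nat)"
    unfolding ks_def map_map
    by (simp add: prod.distinct_set_conv_list[symmetric] atLeastLessThanSuc_atLeastAtMost o_def del: upt_Suc)
  moreover have "card X * prod_list (map fact ks) = fact d"
    using card_blockwise_increasing[of "{1..d}" ks] by (simp add: X_def sum_ks)
  ultimately show ?thesis by (simp add: P_def)
qed

section \<open>The lattice of integer circulations\<close>

context rooted_arcs
begin

definition flows :: "(nat \<Rightarrow> real) \<Rightarrow> ('e \<Rightarrow> real) set" where
  "flows a = {b \<in> A \<rightarrow>\<^sub>E UNIV. \<forall>v\<in>sources. net src tgt A b v = a v}"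

lemma flowsI: "b \<in> A \<rightarrow>\<^sub>E UNIV \<Longrightarrow> (\<And>v. v \<in> sources \<Longrightarrow> net src tgt A b v = a v) \<Longrightarrow> b \<in> flows a"
  unfolding flows_def by blast

lemma flowsD: "b \<in> flows a \<Longrightarrow> v \<in> sources \<Longrightarrow> net src tgt A b v = a v"
  unfolding flows_def by blast

lemma net_restrict: "net src tgt A (restrict b A) v = net src tgt A b v"
  by (intro net_cong) simp

lemma restrict_flow_of_in_flows: "restrict (flow_of a x) A \<in> flows a"
  by (rule flowsI, simp, simp only: net_restrict net_flow_of)

text \<open>A circulation added to any flow is again a flow, and \<open>flow_of\<close> provides
  one, possibly with negative entries.\<close>

lemma direction_space_flows:
  "direction_space A (flows a) = {b \<in> A \<rightarrow>\<^sub>E UNIV. \<forall>v\<in>sources. net src tgt A b v = 0}"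
proof (intro equalityI subsetI)
  fix b assume "b \<in> direction_space A (flows a)"
  then obtain x y where b: "b = (\<lambda>e\<in>A. x e - y e)" and xy: "x \<in> flows a" "y \<in> flows a"
    unfolding direction_space_def by blast
  have "net src tgt A b v = 0" if "v \<in> sources" for v
    unfolding b net_restrict net_diff flowsD[OF xy(1) that] flowsD[OF xy(2) that] by simp
  moreover have "b \<in> A \<rightarrow>\<^sub>E UNIV" by (simp add: b)
  ultimately show "b \<in> {b \<in> A \<rightarrow>\<^sub>E UNIV. \<forall>v\<in>sources. net src tgt A b v = 0}" by blast
next
  fix b :: "'e \<Rightarrow> real" assume b: "b \<in> {b \<in> A \<rightarrow>\<^sub>E UNIV. \<forall>v\<in>sources. net src tgt A b v = 0}"
  let ?y = "restrict (flow_of a (\<lambda>_. 0)) A"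
  let ?x = "\<lambda>e\<in>A. b e + ?y e"
  have y: "?y \<in> flows a" by (rule restrict_flow_of_in_flows)
  have "?x \<in> flows a"
  proof (rule flowsI)
    fix v assume v: "v \<in> sources"
    have "net src tgt A b v = 0" using b v by blast
    then show "net src tgt A ?x v = a v"
      unfolding net_restrict net_add net_flow_of[OF v] by simp
  qed simp
  moreover have "b = (\<lambda>e\<in>A. ?x e - ?y e)"
    using b by (auto simp: fun_eq_iff PiE_iff extensional_def)
  ultimately show "b \<in> direction_space A (flows a)"
    using y unfolding direction_space_def by blast
qed

abbreviation "flow_lattice a \<equiv> direction_space A (flows a) \<inter> (A \<rightarrow>\<^sub>E \<int>)"

lemma in_flow_lattice_iff:
  "b \<in> flow_lattice a \<longleftrightarrow> b \<in> A \<rightarrow>\<^sub>E \<int> \<and> (\<forall>v\<in>sources. net src tgt A b v = 0)"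
  by (auto simp: direction_space_flows PiE_iff)

lemma flow_latticeI:
  "b \<in> A \<rightarrow>\<^sub>E \<int> \<Longrightarrow> (\<And>v. v \<in> sources \<Longrightarrow> net src tgt A b v = 0) \<Longrightarrow> b \<in> flow_lattice a"
  unfolding in_flow_lattice_iff by blast

lemma flow_latticeD:
  assumes "b \<in> flow_lattice a"
  shows "v \<in> sources \<Longrightarrow> net src tgt A b v = 0" and "e \<in> A \<Longrightarrow> b e \<in> \<int>" and "b \<in> extensional A"
  using assms unfolding in_flow_lattice_iff PiE_iff by blast+

lemma restrict_cycle_in_flow_lattice: "f \<in> A \<Longrightarrow> (\<lambda>e\<in>A. of_int (cycle f e)) \<in> flow_lattice a"
  by (rule flow_latticeI, simp, simp only: net_restrict net_of_int net_cycle of_int_0)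

text \<open>On the free arcs the cycles form the identity matrix, so an integer circulation has its
  own free values as coefficients. Existence gives the choice of a basis in
  \<open>lattice_volume\<close> a meaning.\<close>

lemma ex_lattice_basis: "\<exists>B. lattice_basis A (flow_lattice a) (card free_arcs) B"
proof -
  let ?d = "card free_arcs"
  obtain h where h: "bij_betw h {..<?d} free_arcs"
    using ex_bij_betw_nat_finite[of free_arcs] finite_arcs by (auto simp: atLeast0LessThan)
  define B where "B i e = real_of_int (cycle (h i) e)" for i e
  have hA: "h i \<in> A" if "i < ?d" for i using bij_betwE[OF h] that by auto
  have coord: "(\<Sum>i<?d. x i * B i (h j)) = x j" if "j < ?d" for x j
  proof -
    have "(\<Sum>i<?d. x i * B i (h j)) = (\<Sum>i<?d. if i = j then x i else 0)"
    proof (intro sum.cong refl)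
      fix i assume "i \<in> {..<?d}"
      moreover have "h j \<in> free_arcs" using bij_betwE[OF h] that by auto
      moreover have "h j = h i \<longleftrightarrow> i = j"
        using inj_on_eq_iff[OF bij_betw_imp_inj_on[OF h]] that calculation(1) by blast
      ultimately show "x i * B i (h j) = (if i = j then x i else 0)"
        by (simp add: B_def cycle_free)
    qed
    then show ?thesis using that by simp
  qed
  have net_B: "net src tgt A (\<lambda>e. \<Sum>i<?d. x i * B i e) v = 0" if "v \<in> sources" for x v
    unfolding net_sum
  proof (intro sum.neutral ballI)
    fix i assume "i \<in> {..<?d}"
    then have "net src tgt A (cycle (h i)) v = 0" using hA that by (intro net_cycle) simp_all
    then have "net src tgt A (B i) v = 0"
      using net_of_int[of src tgt A "cycle (h i)" v, where 'a = real] unfolding B_def[symmetric] by simp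
    then show "x i * net src tgt A (B i) v = 0" by simp
  qed
  have "flow_lattice a = {\<lambda>e\<in>A. \<Sum>i<?d. of_int (k i) * B i e | k :: nat \<Rightarrow> int. True}"
  proof (intro equalityI subsetI)
    fix b assume b: "b \<in> flow_lattice a"
    define k where "k i = \<lfloor>b (h i)\<rfloor>" for i
    have k: "of_int (k i) = b (h i)" if "i < ?d" for i
    proof -
      have "b (h i) \<in> \<int>" by (rule flow_latticeD(2)[OF b hA[OF that]])
      then show ?thesis by (simp add: k_def)
    qed
    have "b e = (\<Sum>i<?d. of_int (k i) * B i e)" if "e \<in> A" for e
    proof (rule flow_eqI[OF _ _ that])
      show "net src tgt A b v = net src tgt A (\<lambda>e. \<Sum>i<?d. of_int (k i) * B i e) v" if "v \<in> sources" for v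
        unfolding net_B[OF that] by (rule flow_latticeD(1)[OF b that])
      show "b f = (\<Sum>i<?d. of_int (k i) * B i f)" if f: "f \<in> free_arcs" for f
      proof -
        have "f \<in> h ` {..<?d}" using f bij_betw_imp_surj_on[OF h] by simp
        then obtain j where "j < ?d" "f = h j" by auto
        then show ?thesis by (simp add: coord k)
      qed
    qed
    moreover have "b \<in> extensional A" by (rule flow_latticeD(3)[OF b])
    ultimately have "b = (\<lambda>e\<in>A. \<Sum>i<?d. of_int (k i) * B i e)"
      by (intro extensionalityI[of b A]) simp_all
    then show "b \<in> {\<lambda>e\<in>A. \<Sum>i<?d. of_int (k i) * B i e | k :: nat \<Rightarrow> int. True}"
      unfolding mem_Collect_eq by (intro exI[of _ k] conjI TrueI)
  next
    fix b assume "b \<in> {\<lambda>e\<in>A. \<Sum>i<?d. of_int (k i) * B i e | k :: nat \<Rightarrow> int. True}"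
    then have "\<exists>k :: nat \<Rightarrow> int. b = (\<lambda>e\<in>A. \<Sum>i<?d. of_int (k i) * B i e)" by simp
    then obtain k :: "nat \<Rightarrow> int" where b: "b = (\<lambda>e\<in>A. \<Sum>i<?d. of_int (k i) * B i e)"
      by (rule exE)
    have int: "(\<Sum>i<?d. of_int (k i) * B i e) \<in> \<int>" for e
      by (intro Ints_sum Ints_mult) (simp_all add: B_def)
    show "b \<in> flow_lattice a"
      unfolding b by (rule flow_latticeI, simp add: int, simp only: net_restrict net_B)
  qed
  moreover have "\<forall>x :: nat \<Rightarrow> real. (\<forall>e\<in>A. (\<Sum>i<?d. x i * B i e) = 0) \<longrightarrow> (\<forall>i<?d. x i = 0)"
  proof (intro allI impI)
    fix x :: "nat \<Rightarrow> real" and i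
    assume zero: "\<forall>e\<in>A. (\<Sum>i<?d. x i * B i e) = 0" and "i < ?d"
    then have "(\<Sum>j<?d. x j * B j (h i)) = 0" using hA by blast
    then show "x i = 0" unfolding coord[OF \<open>i < ?d\<close>] .
  qed
  ultimately have "lattice_basis A (flow_lattice a) ?d B" unfolding lattice_basis_def by (rule conjI)
  then show ?thesis by (intro exI[of _ B])
qed

text \<open>The basis is arbitrary because the volume is defined with an unspecified one.
  Restriction to the free arcs is injective on circulations, and the cycles, which lie in the
  lattice, restrict to the unit vectors; this gives \<open>kernel\<close> and
  \<open>onto\<close>.\<close>

lemma unimodular_lattice_basis:
  assumes B: "lattice_basis A (flow_lattice a) d B"
  shows "unimodular {..<d} free_arcs B"
    and "v \<in> sources \<Longrightarrow> net src tgt A (\<lambda>e. \<Sum>i<d. x i * B i e) v = 0"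
proof -
  have L: "flow_lattice a = {\<lambda>e\<in>A. \<Sum>i<d. of_int (k i) * B i e | k :: nat \<Rightarrow> int. True}"
    and indep: "\<And>x :: nat \<Rightarrow> real. (\<forall>e\<in>A. (\<Sum>i<d. x i * B i e) = 0) \<Longrightarrow> (\<forall>i<d. x i = 0)"
  proof -
    show "flow_lattice a = {\<lambda>e\<in>A. \<Sum>i<d. of_int (k i) * B i e | k :: nat \<Rightarrow> int. True}"
      using B unfolding lattice_basis_def by (rule conjunct1)
    show "\<forall>i<d. x i = 0" if "\<forall>e\<in>A. (\<Sum>i<d. x i * B i e) = 0" for x :: "nat \<Rightarrow> real"
      using B[unfolded lattice_basis_def, THEN conjunct2, THEN spec[of _ x]] that by (rule mp)
  qed
  \<comment> \<open>\<open>B i\<close> is the combination with a single coefficient 1. The lattice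
    prescribes its values on \<open>A\<close> only, hence the restriction.\<close>
  have BL: "restrict (B i) A \<in> flow_lattice a" if "i < d" for i
  proof -
    have "(\<lambda>e\<in>A. \<Sum>j<d. of_int (if j = i then 1 else 0) * B j e) \<in> flow_lattice a"
      unfolding L mem_Collect_eq by (intro exI[of _ "\<lambda>j. if j = i then 1 else 0"] conjI TrueI refl)
    moreover have "(\<Sum>j<d. of_int (if j = i then 1 else 0) * B j e) = B i e" for e
    proof -
      have "(\<Sum>j<d. of_int (if j = i then 1 else 0) * B j e) = (\<Sum>j<d. if j = i then B i e else 0)"
        by (intro sum.cong) auto
      then show ?thesis using that by simp
    qed
    ultimately show ?thesis by simp
  qed
  have net_B: "net src tgt A (\<lambda>e. \<Sum>i<d. x i * B i e) v = 0" if "v \<in> sources" for x v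
    unfolding net_sum
  proof (intro sum.neutral ballI)
    fix i assume "i \<in> {..<d}"
    then show "x i * net src tgt A (B i) v = 0"
      using flow_latticeD(1)[OF BL that, of i] by (simp add: net_restrict)
  qed
  then show "v \<in> sources \<Longrightarrow> net src tgt A (\<lambda>e. \<Sum>i<d. x i * B i e) v = 0" .
  show "unimodular {..<d} free_arcs B"
  proof
    show "finite {..<d}" "finite free_arcs" using finite_arcs by auto
    show "B i f \<in> \<int>" if "i \<in> {..<d}" "f \<in> free_arcs" for i f
    proof -
      have "restrict (B i) A f \<in> \<int>" using that by (intro flow_latticeD(2)[OF BL]) auto
      then show ?thesis using that by simp
    qed
    show "\<exists>k :: nat \<Rightarrow> int. \<forall>f\<in>free_arcs. (\<Sum>i<d. of_int (k i) * B i f) = (if f = g then 1 else 0)"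
      if g: "g \<in> free_arcs" for g
    proof -
      have "(\<lambda>e\<in>A. of_int (cycle g e)) \<in> flow_lattice a"
        using g by (intro restrict_cycle_in_flow_lattice) simp
      then have "\<exists>k :: nat \<Rightarrow> int. (\<lambda>e\<in>A. real_of_int (cycle g e)) = (\<lambda>e\<in>A. \<Sum>i<d. of_int (k i) * B i e)"
        unfolding L mem_Collect_eq by simp
      then obtain k :: "nat \<Rightarrow> int" where
        k: "(\<lambda>e\<in>A. real_of_int (cycle g e)) = (\<lambda>e\<in>A. \<Sum>i<d. of_int (k i) * B i e)"
        by (rule exE)
      have "(\<Sum>i<d. of_int (k i) * B i f) = (if f = g then 1 else 0)" if "f \<in> free_arcs" for f
      proof -
        have eq: "real_of_int (cycle g f) = (\<Sum>i<d. of_int (k i) * B i f)"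
          using fun_cong[OF k, of f] that by simp
        show ?thesis by (subst eq[symmetric]) (simp add: cycle_free[OF that])
      qed
      then show ?thesis by (intro exI[of _ k] ballI)
    qed
    show "x i = 0" if zero: "\<And>f. f \<in> free_arcs \<Longrightarrow> (\<Sum>i<d. x i * B i f) = 0" and i: "i \<in> {..<d}" for x i
    proof -
      have "\<forall>e\<in>A. (\<Sum>i<d. x i * B i e) = 0"
      proof
        fix e assume e: "e \<in> A"
        show "(\<Sum>i<d. x i * B i e) = 0"
          using net_B zero by (rule net_eq_0_imp_eq_0[of "\<lambda>e. \<Sum>i<d. x i * B i e", OF _ _ e])
      qed
      then show ?thesis using indep i by blast
    qed
  qed
qed

text \<open>The point with lattice coordinates \<open>x\<close> has free coordinates
  \<open>act p x\<close>, so the polytope is the preimage of the flow cell under a unimodular affine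
  map, which preserves the measure.\<close>

lemma lattice_volume_flows:
  assumes a: "\<And>v. v \<in> sources \<Longrightarrow> 0 \<le> a v"
  shows "lattice_volume A (card free_arcs) (flows a) {b \<in> flows a. \<forall>e\<in>A. 0 \<le> b e} =
    lidskii_polynomial src tgt A a"
proof -
  let ?d = "card free_arcs"
  define p where "p = (SOME p. p \<in> flows a)"
  define B where "B = (SOME B. lattice_basis A (flow_lattice a) ?d B)"
  have p: "p \<in> flows a" unfolding p_def by (rule someI[of "\<lambda>p. p \<in> flows a", OF restrict_flow_of_in_flows[of a "\<lambda>_. 0"]])
  have B: "lattice_basis A (flow_lattice a) ?d B"
    unfolding B_def by (rule someI_ex[OF ex_lattice_basis])
  interpret U: unimodular "{..<?d}" free_arcs B by (rule unimodular_lattice_basis(1)[OF B])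
  have "(\<lambda>e\<in>A. p e + (\<Sum>i<?d. x i * B i e)) \<in> {b \<in> flows a. \<forall>e\<in>A. 0 \<le> b e} \<longleftrightarrow>
      U.act p x \<in> flow_cell src tgt A free_arcs a" for x
  proof -
    let ?b = "\<lambda>e. p e + (\<Sum>i<?d. x i * B i e)"
    have net: "net src tgt A ?b v = a v" if "v \<in> sources" for v
      unfolding net_add unimodular_lattice_basis(2)[OF B that] flowsD[OF p that] by simp
    have "?b e = flow_of a (U.act p x) e" if "e \<in> A" for e
      by (rule flow_of_unique[OF net _ that]) (simp_all add: U.act_def)
    moreover have "U.act p x \<in> free_arcs \<rightarrow>\<^sub>E UNIV" by (simp add: U.act_def)
    moreover have "restrict ?b A \<in> flows a"
      by (rule flowsI, simp, simp only: net_restrict net)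
    ultimately show ?thesis unfolding flow_cell_eq by simp
  qed
  then have "{x \<in> {..<?d} \<rightarrow>\<^sub>E UNIV. (\<lambda>e\<in>A. p e + (\<Sum>i<?d. x i * B i e)) \<in> {b \<in> flows a. \<forall>e\<in>A. 0 \<le> b e}} =
      {x \<in> {..<?d} \<rightarrow>\<^sub>E UNIV. U.act p x \<in> flow_cell src tgt A free_arcs a}"
    by (intro Collect_cong conj_cong refl)
  then have "lattice_volume A ?d (flows a) {b \<in> flows a. \<forall>e\<in>A. 0 \<le> b e} =
      measure (lborel_fun {..<?d}) {x \<in> {..<?d} \<rightarrow>\<^sub>E UNIV. U.act p x \<in> flow_cell src tgt A free_arcs a}"
    unfolding lattice_volume_def Let_def p_def[symmetric] B_def[symmetric] by (rule arg_cong)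
  also have "\<dots> = enn2real (emeasure (lborel_fun free_arcs) (flow_cell src tgt A free_arcs a))"
    unfolding measure_def U.emeasure_affine_preimage[OF flow_cell_in_sets] ..
  also have "\<dots> = lidskii_polynomial src tgt A a"
    using emeasure_flow_cell[OF rooted_arcs_axioms a] a
    by (simp add: lidskii_polynomial_nonneg)
  finally show ?thesis .
qed

end

section \<open>The volume formula\<close>

lemma net_flow_eq_net:
  assumes "finite (arcs G)"
  shows "net_flow G b j = net (tail G) (head G) (arcs G) b j"
proof -
  have "out_arcs G j = {e \<in> arcs G. tail G e = j}" "in_arcs G j = {e \<in> arcs G. head G e = j}"
    by (auto simp: out_arcs_def in_arcs_def)
  then show ?thesis
    unfolding net_flow_def net_def sum_subtractf
    using assms by (simp only: sum.inter_filter)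
qed

lemma out_degree_eq_card: "out_degree G v = card {e \<in> arcs G. tail G e = v}"
  by (simp add: out_degree_def out_arcs_def)

definition increasing_labelings :: "nat \<Rightarrow> (nat \<Rightarrow> nat) \<Rightarrow> nat \<Rightarrow> (nat \<Rightarrow> nat) set" where
  "increasing_labelings n s d = {\<sigma>. \<sigma> permutes {1..d} \<and> (\<forall>p. 1 \<le> p \<and> p < d \<and> \<sigma> p > \<sigma> (p + 1) \<longrightarrow>
     (\<exists>i\<in>{1..n}. p = (\<Sum>j=1..i. s j)))}"

lemma labeled_dyck_paths_eq:
  "labeled_dyck_paths n t =
     Sigma (dyck_paths n t) (\<lambda>s. increasing_labelings n s (nat (\<Sum>j=1..n. t j)))"
  unfolding labeled_dyck_paths_def increasing_labelings_def by auto

lemma dyck_path_sum: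
  assumes "s \<in> dyck_paths n t"
  shows "(\<Sum>j=1..n. s j) = nat (\<Sum>j=1..n. t j)"
proof -
  have "(\<Sum>j=1..n. int (s j)) = (\<Sum>j=1..n. t j)"
    using assms unfolding dyck_paths_def by blast
  then have "int (\<Sum>j=1..n. s j) = (\<Sum>j=1..n. t j)" by simp
  then show ?thesis by linarith
qed

lemma finite_dyck_paths: "finite (dyck_paths n t)"
proof (rule finite_subset)
  let ?d = "nat (\<Sum>j=1..n. t j)"
  show "dyck_paths n t \<subseteq> {1..n} \<rightarrow>\<^sub>E {..?d}"
  proof
    fix s assume s: "s \<in> dyck_paths n t"
    have "s j \<le> ?d" if "j \<in> {1..n}" for j
      using member_le_sum[OF that, of s] unfolding dyck_path_sum[OF s, symmetric] by simp
    moreover have "s \<in> extensional {1..n}" using s by (simp add: dyck_paths_def PiE_iff)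
    ultimately show "s \<in> {1..n} \<rightarrow>\<^sub>E {..?d}" by (simp add: PiE_iff)
  qed
qed (intro finite_PiE; simp)

text \<open>The weight is the same for all labelings of a path; their multinomial number turns the
  powers into divided powers.\<close>

lemma sum_labeled_dyck_paths:
  fixes a :: "nat \<Rightarrow> real" and c :: "(nat \<Rightarrow> nat) \<Rightarrow> real"
  shows "(\<Sum>(s, \<sigma>)\<in>labeled_dyck_paths n t. (\<Prod>i=1..n. a i ^ s i) * c s) =
    fact (nat (\<Sum>j=1..n. t j)) * (\<Sum>s\<in>dyck_paths n t. (\<Prod>i=1..n. divided_power (a i) (s i)) * c s)"
proof -
  let ?d = "nat (\<Sum>j=1..n. t j)"
  have fin: "finite (increasing_labelings n s ?d)" for s
    unfolding increasing_labelings_def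
    by (rule finite_subset[of _ "{\<sigma>. \<sigma> permutes {1..?d}}"]) (auto simp: finite_permutations)
  have fibre: "(\<Sum>\<sigma>\<in>increasing_labelings n s ?d. (\<Prod>i=1..n. a i ^ s i) * c s) =
      fact ?d * ((\<Prod>i=1..n. divided_power (a i) (s i)) * c s)" if s: "s \<in> dyck_paths n t" for s
  proof -
    have "card (increasing_labelings n s ?d) * (\<Prod>i=1..n. fact (s i)) = (fact ?d :: nat)"
      using card_permutations_with_descents[where s = s and n = n]
      unfolding increasing_labelings_def dyck_path_sum[OF s] .
    then have "real (card (increasing_labelings n s ?d) * (\<Prod>i=1..n. fact (s i))) = real (fact ?d)"
      by (rule arg_cong)
    then have "real (card (increasing_labelings n s ?d)) = fact ?d / (\<Prod>i=1..n. fact (s i))"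
      by (simp add: field_simps of_nat_prod prod_zero_iff)
    then show ?thesis by (simp add: divided_power_def prod_dividef)
  qed
  have "(\<Sum>(s, \<sigma>)\<in>labeled_dyck_paths n t. (\<Prod>i=1..n. a i ^ s i) * c s) =
      (\<Sum>s\<in>dyck_paths n t. \<Sum>\<sigma>\<in>increasing_labelings n s ?d. (\<Prod>i=1..n. a i ^ s i) * c s)"
    unfolding labeled_dyck_paths_eq using finite_dyck_paths fin by (intro sum.Sigma[symmetric]) blast+
  also have "\<dots> = (\<Sum>s\<in>dyck_paths n t. fact ?d * ((\<Prod>i=1..n. divided_power (a i) (s i)) * c s))"
    by (rule sum.cong[OF refl fibre])
  finally show ?thesis unfolding sum_distrib_left .
qed

text \<open>With \<open>sources_eq\<close>, conservation at the sources is conservation at 1, ...,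
  n, and the inner arcs are those of the restricted graph.\<close>

locale flow_network =
  fixes src tgt :: "'e \<Rightarrow> nat" and A :: "'e set" and n :: nat
  assumes finite_arcs: "finite A"
    and src_less_tgt: "e \<in> A \<Longrightarrow> src e < tgt e"
    and src_pos: "e \<in> A \<Longrightarrow> 1 \<le> src e"
    and sources_eq: "src ` A = {1..n}"
begin

definition exponent_path :: "('e \<Rightarrow> nat) \<Rightarrow> nat \<Rightarrow> nat" where
  "exponent_path b = (\<lambda>v\<in>{1..n}. nat (flow_exponent src tgt A b v))"

lemma ex_rooted_arcs: "\<exists>\<tau>. rooted_arcs src tgt A \<tau>"
proof -
  define \<tau> where "\<tau> v = (SOME e. e \<in> A \<and> src e = v)" for v
  have \<tau>: "\<tau> v \<in> A \<and> src (\<tau> v) = v" if "v \<in> src ` A" for v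
    unfolding \<tau>_def by (rule someI_ex) (use that in auto)
  have "rooted_arcs src tgt A \<tau>"
    using \<tau> finite_arcs src_less_tgt by unfold_locales blast+
  then show ?thesis by (intro exI[of _ \<tau>])
qed

lemma finite_exponent_flows: "finite (exponent_flows src tgt A)"
proof -
  obtain \<tau> where "rooted_arcs src tgt A \<tau>" using ex_rooted_arcs by (rule exE)
  from emeasure_flow_cell[OF this, of "\<lambda>_. 0"] show ?thesis by simp
qed

text \<open>Summation over an initial segment leaves the flow across the cut: what leaves 1, ..., k
  minus what enters.\<close>

lemma sum_net:
  fixes b :: "'e \<Rightarrow> int"
  assumes "I \<subseteq> A"
  shows "(\<Sum>v=1..k. net src tgt I b v) =
    (\<Sum>e\<in>I. b e * ((if src e \<le> k then 1 else 0) - (if tgt e \<le> k then 1 else 0)))"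
proof -
  have "(\<Sum>v=1..k. net src tgt I b v) =
      (\<Sum>e\<in>I. \<Sum>v=1..k. (if src e = v then b e else 0) - (if tgt e = v then b e else 0))"
    unfolding net_def by (rule sum.swap)
  also have "\<dots> = (\<Sum>e\<in>I. b e * ((if src e \<le> k then 1 else 0) - (if tgt e \<le> k then 1 else 0)))"
  proof (intro sum.cong refl)
    fix e assume "e \<in> I"
    then have "1 \<le> src e" "1 \<le> tgt e" using assms src_pos[of e] src_less_tgt[of e] by auto
    then show "(\<Sum>v=1..k. (if src e = v then b e else 0) - (if tgt e = v then b e else 0)) =
        b e * ((if src e \<le> k then 1 else 0) - (if tgt e \<le> k then 1 else 0))"
      by (simp add: sum_subtractf)
  qed
  finally show ?thesis .
qed

lemma sum_out_degrees: "(\<Sum>v=1..n. int (card {e \<in> A. src e = v}) - 1) = int (card A) - int n"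
proof -
  have "card A = (\<Sum>v\<in>src ` A. card {e \<in> A. src e = v})"
    using sum.image_gen[OF finite_arcs, of "\<lambda>_. 1 :: nat" src] by simp
  then show ?thesis by (simp add: sum_subtractf sources_eq)
qed

text \<open>Arcs increase, so the flow across each cut is nonnegative, which is the Dyck condition;
  an inner arc has both ends in 1, ..., n, which gives the total.\<close>

lemma exponent_path_dyck:
  assumes b: "b \<in> exponent_flows src tgt A"
  shows "exponent_path b \<in> dyck_paths n (\<lambda>v. int (card {e \<in> A. src e = v}) - 1)"
proof -
  let ?I = "inner_arcs src tgt A" and ?t = "\<lambda>v. int (card {e \<in> A. src e = v}) - 1"
  have I: "?I \<subseteq> A" by (auto simp: inner_arcs_def)
  have nonneg: "0 \<le> flow_exponent src tgt A b v" if "v \<in> {1..n}" for v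
  proof -
    have "v \<in> src ` A" using that sources_eq by simp
    then show ?thesis using b unfolding exponent_flows_def by blast
  qed
  have partial: "(\<Sum>v=1..k. int (exponent_path b v)) =
      (\<Sum>v=1..k. ?t v) + (\<Sum>v=1..k. net src tgt ?I (\<lambda>e. int (b e)) v)" if "k \<le> n" for k
    unfolding sum.distrib[symmetric]
  proof (intro sum.cong refl)
    fix v assume "v \<in> {1..k}"
    then have "v \<in> {1..n}" using that by auto
    then show "int (exponent_path b v) = ?t v + net src tgt ?I (\<lambda>e. int (b e)) v"
      using nonneg[of v] unfolding exponent_path_def flow_exponent_def by simp
  qed
  have "(\<Sum>v=1..n. net src tgt ?I (\<lambda>e. int (b e)) v) = 0"
    unfolding sum_net[OF I]
  proof (intro sum.neutral ballI)
    fix e assume "e \<in> ?I"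
    then have "src e \<in> {1..n}" "tgt e \<in> {1..n}"
      unfolding sources_eq[symmetric] by (auto simp: inner_arcs_def)
    then show "int (b e) * ((if src e \<le> n then 1 else 0) - (if tgt e \<le> n then 1 else 0)) = 0" by simp
  qed
  moreover have "0 \<le> (\<Sum>v=1..k. net src tgt ?I (\<lambda>e. int (b e)) v)" for k
    unfolding sum_net[OF I]
  proof (intro sum_nonneg)
    fix e assume "e \<in> ?I"
    then have "src e < tgt e" using I src_less_tgt by blast
    then show "0 \<le> int (b e) * ((if src e \<le> k then 1 else 0) - (if tgt e \<le> k then 1 else 0))" by simp
  qed
  moreover have "exponent_path b \<in> {1..n} \<rightarrow>\<^sub>E UNIV" by (simp add: exponent_path_def)
  ultimately show ?thesis
    unfolding dyck_paths_def mem_Collect_eq using partial by (intro conjI ballI) simp_all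
qed

text \<open>The product depends on a flow only through its exponents, so flows with the same path
  are collected.\<close>

lemma lidskii_polynomial_eq_sum_dyck:
  "lidskii_polynomial src tgt A a =
    (\<Sum>s\<in>dyck_paths n (\<lambda>v. int (card {e \<in> A. src e = v}) - 1).
       (\<Prod>i=1..n. divided_power (a i) (s i)) * real (card {b \<in> exponent_flows src tgt A. exponent_path b = s}))"
proof -
  let ?T = "dyck_paths n (\<lambda>v. int (card {e \<in> A. src e = v}) - 1)"
  have "lidskii_polynomial src tgt A a =
      (\<Sum>b\<in>exponent_flows src tgt A. \<Prod>v=1..n. divided_power (a v) (exponent_path b v))"
    unfolding lidskii_polynomial_def sources_eq exponent_path_def by simp
  also have "\<dots> = (\<Sum>s\<in>?T. \<Sum>b\<in>{b \<in> exponent_flows src tgt A. exponent_path b = s}.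
      \<Prod>v=1..n. divided_power (a v) (exponent_path b v))"
    using exponent_path_dyck
    by (intro sum.group[symmetric] finite_exponent_flows finite_dyck_paths) blast
  also have "\<dots> = (\<Sum>s\<in>?T. \<Sum>b\<in>{b \<in> exponent_flows src tgt A. exponent_path b = s}.
      \<Prod>v=1..n. divided_power (a v) (s v))"
    by (intro sum.cong refl) simp
  finally show ?thesis by (simp add: mult.commute)
qed

end

text \<open>That the net flow is s - t says that the exponent, t plus net flow, equals s. As
  \<open>s\<close> is natural, the exponent is then nonnegative and \<open>nat\<close> loses
  nothing.\<close>

lemma kostant_eq_card_exponent_flows:
  assumes "flow_network (tail G) (head G) (arcs G) n" and s: "s \<in> {1..n} \<rightarrow>\<^sub>E UNIV"
  shows "kostant (G \<restriction> {1..n}) n (\<lambda>i. int (s i) - shifted_out_degree G i) =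
    card {b \<in> exponent_flows (tail G) (head G) (arcs G). flow_network.exponent_path (tail G) (head G) (arcs G) n b = s}"
proof -
  interpret flow_network "tail G" "head G" "arcs G" n by fact
  let ?I = "inner_arcs (tail G) (head G) (arcs G)"
  have arcs: "arcs (G \<restriction> {1..n}) = ?I"
    unfolding inner_arcs_def sources_eq using sources_eq by (auto simp: induce_subgraph_def)
  have net: "(\<Sum>e\<in>?I. int (b e) * (unit_vec (tail G e) k - unit_vec (head G e) k)) =
      net (tail G) (head G) ?I (\<lambda>e. int (b e)) k" for b k
    unfolding net_def by (intro sum.cong refl) (auto simp: unit_vec_def)
  have eq: "flow_exponent (tail G) (head G) (arcs G) b k =
      shifted_out_degree G k + net (tail G) (head G) ?I (\<lambda>e. int (b e)) k" for b k
    by (simp add: flow_exponent_def shifted_out_degree_def out_degree_eq_card)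
  have iff: "(\<forall>k\<in>{1..n}. (\<Sum>e\<in>?I. int (b e) * (unit_vec (tail G e) k - unit_vec (head G e) k)) =
        int (s k) - shifted_out_degree G k) \<longleftrightarrow>
      (\<forall>k\<in>{1..n}. 0 \<le> flow_exponent (tail G) (head G) (arcs G) b k) \<and> exponent_path b = s" for b
  proof -
    have "exponent_path b = s \<longleftrightarrow> (\<forall>k\<in>{1..n}. nat (flow_exponent (tail G) (head G) (arcs G) b k) = s k)"
    proof
      assume R: "\<forall>k\<in>{1..n}. nat (flow_exponent (tail G) (head G) (arcs G) b k) = s k"
      have "exponent_path b \<in> extensional {1..n}" "s \<in> extensional {1..n}"
        using s by (simp_all add: exponent_path_def PiE_iff)
      then show "exponent_path b = s"
        by (rule extensionalityI) (use R in \<open>simp add: exponent_path_def\<close>)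
    qed (auto simp: exponent_path_def)
    moreover have "net (tail G) (head G) ?I (\<lambda>e. int (b e)) k = int (s k) - shifted_out_degree G k \<longleftrightarrow>
        0 \<le> flow_exponent (tail G) (head G) (arcs G) b k \<and>
        nat (flow_exponent (tail G) (head G) (arcs G) b k) = s k" for k
      unfolding eq by linarith
    ultimately show ?thesis unfolding net by blast
  qed
  have "tail (G \<restriction> {1..n}) = tail G" "head (G \<restriction> {1..n}) = head G"
    by (simp_all add: induce_subgraph_def)
  then have "kostant (G \<restriction> {1..n}) n (\<lambda>i. int (s i) - shifted_out_degree G i) =
      card {b \<in> ?I \<rightarrow>\<^sub>E (UNIV :: nat set). \<forall>k\<in>{1..n}.
        (\<Sum>e\<in>?I. int (b e) * (unit_vec (tail G e) k - unit_vec (head G e) k)) = int (s k) - shifted_out_degree G k}"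
    unfolding kostant_def arcs by (simp only:)
  also have "\<dots> = card {b \<in> exponent_flows (tail G) (head G) (arcs G). exponent_path b = s}"
    unfolding exponent_flows_def iff sources_eq by (rule arg_cong[where f = card]) blast
  finally show ?thesis .
qed

lemma flow_volume_eq_lidskii_polynomial:
  assumes "flow_network (tail G) (head G) (arcs G) n" and "\<And>i. i \<in> {1..n} \<Longrightarrow> 0 \<le> a i"
  shows "flow_volume G n a =
    fact (card (arcs G) - n) * lidskii_polynomial (tail G) (head G) (arcs G) a"
proof -
  interpret flow_network "tail G" "head G" "arcs G" n by fact
  obtain \<tau> where "rooted_arcs (tail G) (head G) (arcs G) \<tau>" using ex_rooted_arcs by (rule exE)
  then interpret rooted_arcs "tail G" "head G" "arcs G" \<tau> .
  have space: "flow_space G n a = flows a"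
    unfolding flow_space_def flows_def sources_eq net_flow_eq_net[OF finite_arcs] ..
  have "flow_polytope G n a = {b \<in> flows a. \<forall>e\<in>arcs G. 0 \<le> b e}"
    unfolding flow_polytope_def space ..
  moreover have "card (arcs G) - n = card (arcs G - \<tau> ` tail G ` arcs G)"
    using card_free_arcs by (simp add: sources_eq)
  ultimately show ?thesis
    unfolding flow_volume_def space using lattice_volume_flows[of a] assms(2) sources_eq by simp
qed

text \<open>At a sink the net flow is at most 0, so a positive \<open>a v\<close> leaves the
  polytope empty.\<close>

lemma flow_volume_eq_0_if_sink:
  assumes "finite (arcs G)" and v: "v \<in> {1..n}" and sink: "out_degree G v = 0" and a: "0 < a v"
  shows "flow_volume G n a = 0"
proof -
  have none: "tail G e \<noteq> v" if "e \<in> arcs G" for e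
    using sink assms(1) that by (auto simp: out_degree_eq_card)
  have "b \<notin> flow_polytope G n a" for b
  proof
    assume b: "b \<in> flow_polytope G n a"
    then have "net_flow G b v = a v" and nonneg: "\<forall>e\<in>arcs G. 0 \<le> b e"
      using v unfolding flow_polytope_def flow_space_def by blast+
    moreover have "net_flow G b v \<le> 0"
      unfolding net_flow_eq_net[OF assms(1)] net_def
      by (intro sum_nonpos) (use none nonneg in simp)
    ultimately show False using a by simp
  qed
  then have "flow_polytope G n a = {}" by blast
  then show ?thesis by (simp add: flow_volume_def lattice_volume_def)
qed

text \<open>At a sink t_v = -1, so the net flow would have to be s_v + 1 > 0, but no arc leaves
  \<open>v\<close>.\<close>

lemma kostant_eq_0_if_sink:
  assumes v: "v \<in> {1..n}" and sink: "out_degree G v = 0" and fin: "finite (arcs G)"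
  shows "kostant (G \<restriction> {1..n}) n (\<lambda>i. int (s i) - shifted_out_degree G i) = 0"
proof -
  have none: "tail G e \<noteq> v" if "e \<in> arcs (G \<restriction> {1..n})" for e
    using sink fin that by (auto simp: out_degree_eq_card induce_subgraph_def)
  have t: "shifted_out_degree G v = -1" by (simp add: shifted_out_degree_def sink)
  have "\<not> (\<forall>k\<in>{1..n}. (\<Sum>e\<in>arcs (G \<restriction> {1..n}). int (b e) *
      (unit_vec (tail (G \<restriction> {1..n}) e) k - unit_vec (head (G \<restriction> {1..n}) e) k)) =
      int (s k) - shifted_out_degree G k)" for b
  proof -
    have "(\<Sum>e\<in>arcs (G \<restriction> {1..n}). int (b e) *
      (unit_vec (tail (G \<restriction> {1..n}) e) v - unit_vec (head (G \<restriction> {1..n}) e) v)) \<le> 0"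
    proof (intro sum_nonpos)
      fix e assume "e \<in> arcs (G \<restriction> {1..n})"
      then have "unit_vec (tail (G \<restriction> {1..n}) e) v = 0"
        using none[of e] by (simp add: unit_vec_def)
      then show "int (b e) * (unit_vec (tail (G \<restriction> {1..n}) e) v - unit_vec (head (G \<restriction> {1..n}) e) v) \<le> 0"
        by (simp add: unit_vec_def)
    qed
    then have "(\<Sum>e\<in>arcs (G \<restriction> {1..n}). int (b e) *
      (unit_vec (tail (G \<restriction> {1..n}) e) v - unit_vec (head (G \<restriction> {1..n}) e) v)) \<noteq>
      int (s v) - shifted_out_degree G v" unfolding t by linarith
    then show ?thesis using v by blast
  qed
  then have "{b \<in> arcs (G \<restriction> {1..n}) \<rightarrow>\<^sub>E (UNIV :: nat set). \<forall>k\<in>{1..n}.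
      (\<Sum>e\<in>arcs (G \<restriction> {1..n}). int (b e) *
        (unit_vec (tail (G \<restriction> {1..n}) e) k - unit_vec (head (G \<restriction> {1..n}) e) k)) =
      int (s k) - shifted_out_degree G k} = {}" by blast
  then show ?thesis unfolding kostant_def by (simp only: card.empty)
qed

text \<open>\<open>outgoing\<close> excludes a genuine exception, sinks among 1, ..., n with zero
  net flow: for n = 2, the arcs 1 -> 2 and 1 -> 3 and a_2 = 0, the polytope is a point of volume 1,
  but t = (1, -1) has no Dyck path.\<close>

theorem theorem4p3:
  fixes G :: "(nat, 'e) pre_digraph" and n :: nat and a :: "nat \<Rightarrow> nat"
  defines "t \<equiv> shifted_out_degree G"
  assumes "fin_digraph G"
    and "verts G = {1..n+1}"
    and "\<forall>e\<in>arcs G. tail G e < head G e"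
    and "Digraph_Component.connected G"
    and outgoing: "\<forall>i\<in>{1..n}. a i = 0 \<longrightarrow> out_degree G i \<ge> 1"
  shows "flow_volume G n (\<lambda>i. real (a i)) =
    (\<Sum>(s, \<sigma>)\<in>labeled_dyck_paths n t.
       (\<Prod>i=1..n. real (a i) ^ s i) * real (kostant (G \<restriction> {1..n}) n (\<lambda>i. int (s i) - t i)))"
proof (cases "\<exists>v\<in>{1..n}. out_degree G v = 0")
  case True
  then obtain v where v: "v \<in> {1..n}" "out_degree G v = 0" by blast
  interpret fin_digraph G by fact
  \<comment> \<open>A sink among 1, ..., n has positive net flow by \<open>outgoing\<close>: the
    polytope is empty and all Kostant numbers vanish.\<close>
  have "a v = 0 \<longrightarrow> out_degree G v \<ge> 1" using outgoing v(1) by (rule bspec)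
  then have "0 < real (a v)" using v(2) by simp
  from flow_volume_eq_0_if_sink[OF finite_arcs v, where a = "\<lambda>i. real (a i)", OF this]
  show ?thesis
    unfolding t_def kostant_eq_0_if_sink[OF v finite_arcs] by simp
next
  case False
  interpret fin_digraph G by fact
  have less: "tail G e < head G e" if "e \<in> arcs G" for e
    using assms(4) that by blast
  have range: "tail G e \<in> {1..n+1}" "head G e \<in> {1..n+1}" if "e \<in> arcs G" for e
    using tail_in_verts[OF that] head_in_verts[OF that] assms(3) by simp_all
  have "tail G ` arcs G = {1..n}"
  proof (intro equalityI subsetI)
    fix v assume "v \<in> tail G ` arcs G"
    then obtain e where e: "e \<in> arcs G" "v = tail G e" by blast
    \<comment> \<open>The last vertex n + 1 is no tail, as the head would have to exceed it.\<close>
    then show "v \<in> {1..n}" using less[OF e(1)] range[OF e(1)] by simp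
  next
    fix v assume "v \<in> {1..n}"
    then have "{e \<in> arcs G. tail G e = v} \<noteq> {}"
      using False unfolding out_degree_eq_card by (metis card.empty)
    then show "v \<in> tail G ` arcs G" by blast
  qed
  then have network: "flow_network (tail G) (head G) (arcs G) n"
    using finite_arcs less range by unfold_locales simp_all
  interpret flow_network "tail G" "head G" "arcs G" n by (rule network)
  have t: "t = (\<lambda>v. int (card {e \<in> arcs G. tail G e = v}) - 1)"
    by (simp add: t_def shifted_out_degree_def out_degree_eq_card fun_eq_iff)
  have d: "nat (\<Sum>j=1..n. t j) = card (arcs G) - n"
    unfolding t sum_out_degrees by simp
  have "flow_volume G n (\<lambda>i. real (a i)) = fact (card (arcs G) - n) *
      lidskii_polynomial (tail G) (head G) (arcs G) (\<lambda>i. real (a i))"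
    by (rule flow_volume_eq_lidskii_polynomial[OF network]) simp
  also have "lidskii_polynomial (tail G) (head G) (arcs G) (\<lambda>i. real (a i)) =
      (\<Sum>s\<in>dyck_paths n t. (\<Prod>i=1..n. divided_power (real (a i)) (s i)) *
        real (kostant (G \<restriction> {1..n}) n (\<lambda>i. int (s i) - t i)))"
    unfolding lidskii_polynomial_eq_sum_dyck t[symmetric]
  proof (intro sum.cong refl)
    fix s assume "s \<in> dyck_paths n t"
    then have "s \<in> {1..n} \<rightarrow>\<^sub>E UNIV" by (simp add: dyck_paths_def)
    then show "(\<Prod>i=1..n. divided_power (real (a i)) (s i)) *
        real (card {b \<in> exponent_flows (tail G) (head G) (arcs G). exponent_path b = s}) =
        (\<Prod>i=1..n. divided_power (real (a i)) (s i)) *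
        real (kostant (G \<restriction> {1..n}) n (\<lambda>i. int (s i) - t i))"
      unfolding t_def by (simp only: kostant_eq_card_exponent_flows[OF network])
  qed
  finally show ?thesis unfolding sum_labeled_dyck_paths d .
qed

end
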